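(* Let $\gamma>0$. For any fixed $\varepsilon\in(0,1)$, $$n(d,\varepsilon)=\frac{d^{N_\omega(\varepsilon)}}{N_\omega(\varepsilon)!}+O\bigl(d^{N_\omega(\varepsilon)-1}\bigr),\qquad d\to\infty,$$ where $N_\omega(\varepsilon):=\max\bigl\{m\in\mathbb{N}_0: m<c_\omega|\ln\varepsilon^2|\bigr\}$ and $n(d,\varepsilon)$ is the worst case information complexity of the $d$-variate approximation problem for the Gaussian kernel with shape parameter $\gamma$.
   Context: $\mathbb{N}$ is the set of positive integers and $\mathbb{N}_0=\mathbb{N}\cup\{0\}$. Fix a shape parameter $\gamma>0$ (the same for all $d$) and set $$\omega:=\frac{2\gamma^2}{1+2\gamma^2+\sqrt{1+4\gamma^2}}\in(0,1),\qquad c_\omega:=\frac{1}{|\ln\omega|}.$$ For $d\in\mathbb{N}$, $H_{d,\gamma}$ is the (real) reproducing kernel Hilbert space of functions on $\mathbb{R}^d$ with kernel $\mathcal{K}_d(t,s)=\prod_{j=1}^d\exp\{-\gamma^2(t_j-s_j)^2\}$, and $L_{2,d}$ is the space of functions with finite norm $\|f\|_{L_{2,d}}=\bigl(\int_{\mathbb{R}^d}f^2(x)\prod_{j=1}^d\frac{e^{-x_j^2}}{\sqrt{\pi}}\,\mathrm{d}x\bigr)^{1/2}$. The approximation problem is the embedding $\mathrm{APP}_d:H_{d,\gamma}\to L_{2,d}$, $\mathrm{APP}_df=f$. For $n\in\mathbb{N}$ let $\mathcal{A}_{d,n}$ be the class of linear algorithms $A_{d,n}f=\sum_{k=1}^n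 a_k\,\ell_kf$ with $a_k\in L_{2,d}$ and $\ell_k\in H_{d,\gamma}^*$. Put $$e(d,n)=\inf_{A_{d,n}\in\mathcal{A}_{d,n}}\ \sup_{\|f\|_{H_{d,\gamma}}\le 1}\|\mathrm{APP}_df-A_{d,n}f\|_{L_{2,d}},\qquad e(d,0)=\sup_{\|f\|_{H_{d,\gamma}}\le1}\|f\|_{L_{2,d}}.$$ The worst case information complexity (normalized criterion) is $$n(d,\varepsilon)=\min\{n\in\mathbb{N}: e(d,n)\le\varepsilon\,e(d,0)\},\qquad \varepsilon\in(0,1),\ d\in\mathbb{N}.$$ Known facts recalled in the problem setting: $n(d,\varepsilon)=\min\{n\in\mathbb{N}:\lambda_{d,n+1}\le\varepsilon^2\lambda_{d,1}\}$, where $(\lambda_{d,m})_{m\in\mathbb{N}}$ is the non-increasing arrangement (with multiplicity) of the products $\prod_{j=1}^d\lambda_{k_j}$, $k_1,\dots,k_d\in\mathbb{N}$, with $\lambda_k=(1-\omega)\omega^{k-1}$, $k\in\mathbb{N}$. *)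

theory Defs
  imports "HOL-Analysis.Analysis" "HOL-Library.Landau_Symbols"
begin

section \<open>Hilbert spaces of functions and reproducing kernels\<close>

text \<open>
  A real function on a set \<open>X\<close> is represented by the total function that extends it by
  zero, so that the vector space operations are the pointwise ones and equality of functions on
  \<open>X\<close> is equality in HOL. Only the values of the inner product \<open>ip\<close> on \<open>H \<times> H\<close> matter.
\<close>

definition hnorm :: "(('x \<Rightarrow> real) \<Rightarrow> ('x \<Rightarrow> real) \<Rightarrow> real) \<Rightarrow> ('x \<Rightarrow> real) \<Rightarrow> real" where
  "hnorm ip f = sqrt (ip f f)"

locale function_hilbert_space =
  fixes X :: "'x set"
    and H :: "('x \<Rightarrow> real) set"
    and ip :: "('x \<Rightarrow> real) \<Rightarrow> ('x \<Rightarrow> real) \<Rightarrow> real"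
  assumes supp: "f \<in> H \<Longrightarrow> x \<notin> X \<Longrightarrow> f x = 0"
    and zero_closed: "(\<lambda>x. 0) \<in> H"
    and add_closed: "f \<in> H \<Longrightarrow> g \<in> H \<Longrightarrow> (\<lambda>x. f x + g x) \<in> H"
    and scale_closed: "f \<in> H \<Longrightarrow> (\<lambda>x. c * f x) \<in> H"
    and ip_commute: "f \<in> H \<Longrightarrow> g \<in> H \<Longrightarrow> ip f g = ip g f"
    and ip_add_left:
      "f \<in> H \<Longrightarrow> g \<in> H \<Longrightarrow> h \<in> H \<Longrightarrow> ip (\<lambda>x. f x + g x) h = ip f h + ip g h"
    and ip_scale_left: "f \<in> H \<Longrightarrow> g \<in> H \<Longrightarrow> ip (\<lambda>x. c * f x) g = c * ip f g"
    and ip_nonneg: "f \<in> H \<Longrightarrow> 0 \<le> ip f f"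
    and ip_definite: "f \<in> H \<Longrightarrow> ip f f = 0 \<Longrightarrow> f = (\<lambda>x. 0)"
    and complete:
      "\<lbrakk>\<And>n. F n \<in> H;
        \<And>e. 0 < e \<Longrightarrow> \<exists>M. \<forall>m\<ge>M. \<forall>n\<ge>M. hnorm ip (\<lambda>x. F m x - F n x) < e\<rbrakk>
       \<Longrightarrow> \<exists>f\<in>H. (\<lambda>n. hnorm ip (\<lambda>x. F n x - f x)) \<longlonglongrightarrow> 0"

text \<open>
  For a positive semidefinite kernel \<open>K\<close> there is exactly one reproducing kernel Hilbert space
  (Moore--Aronszajn); \<open>rkhs X H ip K\<close> says that \<open>H\<close> with inner product \<open>ip\<close> is that space.
\<close>

locale rkhs = function_hilbert_space X H ip
  for X :: "'x set"
    and H :: "('x \<Rightarrow> real) set"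
    and ip :: "('x \<Rightarrow> real) \<Rightarrow> ('x \<Rightarrow> real) \<Rightarrow> real" +
  fixes K :: "'x \<Rightarrow> 'x \<Rightarrow> real"
  assumes kernel_mem: "s \<in> X \<Longrightarrow> (\<lambda>t. if t \<in> X then K t s else 0) \<in> H"
    and reproducing:
      "s \<in> X \<Longrightarrow> f \<in> H \<Longrightarrow> ip f (\<lambda>t. if t \<in> X then K t s else 0) = f s"

definition hdual ::
  "('x \<Rightarrow> real) set \<Rightarrow> (('x \<Rightarrow> real) \<Rightarrow> ('x \<Rightarrow> real) \<Rightarrow> real) \<Rightarrow> (('x \<Rightarrow> real) \<Rightarrow> real) set" where
  "hdual H ip = {l.
     (\<forall>f\<in>H. \<forall>g\<in>H. l (\<lambda>x. f x + g x) = l f + l g) \<and>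
     (\<forall>c. \<forall>f\<in>H. l (\<lambda>x. c * f x) = c * l f) \<and>
     (\<exists>C. \<forall>f\<in>H. \<bar>l f\<bar> \<le> C * hnorm ip f)}"

definition hball ::
  "('x \<Rightarrow> real) set \<Rightarrow> (('x \<Rightarrow> real) \<Rightarrow> ('x \<Rightarrow> real) \<Rightarrow> real) \<Rightarrow> ('x \<Rightarrow> real) set" where
  "hball H ip = {f \<in> H. hnorm ip f \<le> 1}"


section \<open>The Gaussian kernel and the weighted \<open>L\<^sub>2\<close> space\<close>

text \<open>
  As the dimension varies, \<open>\<real>\<^sup>d\<close> is the set of functions on the index set \<open>{..<d}\<close>;
  it is the space of the product measure below.
\<close>

definition Rd :: "nat \<Rightarrow> (nat \<Rightarrow> real) set" where
  "Rd d = {..<d} \<rightarrow>\<^sub>E UNIV"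

definition gauss_kernel :: "real \<Rightarrow> nat \<Rightarrow> (nat \<Rightarrow> real) \<Rightarrow> (nat \<Rightarrow> real) \<Rightarrow> real" where
  "gauss_kernel \<gamma> d t s = (\<Prod>j<d. exp (- \<gamma>\<^sup>2 * (t j - s j)\<^sup>2))"

definition gauss_measure :: "nat \<Rightarrow> (nat \<Rightarrow> real) measure" where
  "gauss_measure d =
     density (\<Pi>\<^sub>M j\<in>{..<d}. lborel) (\<lambda>x. ennreal (\<Prod>j<d. exp (- (x j)\<^sup>2) / sqrt pi))"

definition L2 :: "nat \<Rightarrow> ((nat \<Rightarrow> real) \<Rightarrow> real) set" where
  "L2 d = {f \<in> borel_measurable (gauss_measure d). integrable (gauss_measure d) (\<lambda>x. (f x)\<^sup>2)}"

definition L2_norm :: "nat \<Rightarrow> ((nat \<Rightarrow> real) \<Rightarrow> real) \<Rightarrow> real" where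
  "L2_norm d f = sqrt (LINT x|gauss_measure d. (f x)\<^sup>2)"


section \<open>Worst case errors and information complexity\<close>

text \<open>
  The suprema and infima below are over nonempty bounded sets of reals if \<open>H\<close> is the Gaussian
  reproducing kernel Hilbert space on \<open>Rd d\<close>: its elements are continuous and satisfy
  \<open>\<bar>f x\<bar> \<le> hnorm ip f\<close> on \<open>Rd d\<close>, hence lie in \<open>L2 d\<close> with \<open>L2_norm d f \<le> hnorm ip f\<close>.
\<close>

definition linear_algorithms ::
  "((nat \<Rightarrow> real) \<Rightarrow> real) set \<Rightarrow> (((nat \<Rightarrow> real) \<Rightarrow> real) \<Rightarrow> ((nat \<Rightarrow> real) \<Rightarrow> real) \<Rightarrow> real)
    \<Rightarrow> nat \<Rightarrow> nat \<Rightarrow> (((nat \<Rightarrow> real) \<Rightarrow> real) \<Rightarrow> ((nat \<Rightarrow> real) \<Rightarrow> real)) set" where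
  "linear_algorithms H ip d n =
     {A. \<exists>a l. (\<forall>k\<in>{1..n}. a k \<in> L2 d \<and> l k \<in> hdual H ip) \<and>
               A = (\<lambda>f x. \<Sum>k=1..n. a k x * l k f)}"

definition min_error ::
  "((nat \<Rightarrow> real) \<Rightarrow> real) set \<Rightarrow> (((nat \<Rightarrow> real) \<Rightarrow> real) \<Rightarrow> ((nat \<Rightarrow> real) \<Rightarrow> real) \<Rightarrow> real)
    \<Rightarrow> nat \<Rightarrow> nat \<Rightarrow> real" where
  "min_error H ip d n =
     (INF A\<in>linear_algorithms H ip d n. SUP f\<in>hball H ip. L2_norm d (\<lambda>x. f x - A f x))"

definition initial_error ::
  "((nat \<Rightarrow> real) \<Rightarrow> real) set \<Rightarrow> (((nat \<Rightarrow> real) \<Rightarrow> real) \<Rightarrow> ((nat \<Rightarrow> real) \<Rightarrow> real) \<Rightarrow> real)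
    \<Rightarrow> nat \<Rightarrow> real" where
  "initial_error H ip d = (SUP f\<in>hball H ip. L2_norm d f)"

definition info_complexity ::
  "((nat \<Rightarrow> real) \<Rightarrow> real) set \<Rightarrow> (((nat \<Rightarrow> real) \<Rightarrow> real) \<Rightarrow> ((nat \<Rightarrow> real) \<Rightarrow> real) \<Rightarrow> real)
    \<Rightarrow> nat \<Rightarrow> real \<Rightarrow> nat" where
  "info_complexity H ip d \<epsilon> =
     (LEAST n. 1 \<le> n \<and> min_error H ip d n \<le> \<epsilon> * initial_error H ip d)"


section \<open>The exponent\<close>

definition omega :: "real \<Rightarrow> real" where
  "omega \<gamma> = 2 * \<gamma>\<^sup>2 / (1 + 2 * \<gamma>\<^sup>2 + sqrt (1 + 4 * \<gamma>\<^sup>2))"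

definition c_omega :: "real \<Rightarrow> real" where
  "c_omega \<gamma> = 1 / \<bar>ln (omega \<gamma>)\<bar>"

definition N_omega :: "real \<Rightarrow> real \<Rightarrow> nat" where
  "N_omega \<gamma> \<epsilon> = Max {m. real m < c_omega \<gamma> * \<bar>ln (\<epsilon>\<^sup>2)\<bar>}"

end

theory Submission
  imports Defs "HOL-Probability.Distributions" "HOL-Real_Asymp.Real_Asymp"
begin

text \<open>
  The information complexity is in fact known exactly: with \<open>N = N_omega \<gamma> \<epsilon>\<close> and \<open>d \<ge> 1\<close> it is the
  binomial coefficient \<open>(N + d) choose N\<close> (\<open>info_complexity_eq\<close>), a polynomial in \<open>d\<close> with leading
  term \<open>d ^ N / fact N\<close>. This number counts the multi-indices \<open>k\<close> in \<open>d\<close> variables with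
  \<open>\<bar>k\<bar> \<le> N\<close>, that is, the eigenvalues \<open>(1 - \<omega>) ^ d * \<omega> ^ \<bar>k\<bar>\<close> of the Gaussian integral operator
  that exceed \<open>\<epsilon>\<^sup>2\<close> times the largest one.

  An abstract part shows that the \<open>n\<close>-th minimal squared error is governed by the eigenvalues of
  \<open>g \<mapsto> \<integral> K(\<cdot>, s) g(s)\<close> on \<open>L\<^sub>2\<close>. By the Riesz representation theorem an eigenfunction lies in the
  reproducing kernel Hilbert space, and there the inner product with it is the \<open>L\<^sub>2\<close> inner product
  divided by the eigenvalue (\<open>eigenfunction_mem\<close>). A system of eigenfunctions that is orthonormal in
  \<open>L\<^sub>2\<close> is therefore orthogonal in \<open>H\<close> as well. That it spans enough of \<open>H\<close> follows from the trace: if the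
  eigenvalues found add up to the integral of \<open>K(x, x)\<close>, then for every \<open>g\<close> in \<open>H\<close> that is orthogonal
  to finitely many of the eigenfunctions the squared \<open>L\<^sub>2\<close> norm is at most \<open>ip g g\<close> times what
  their eigenvalues leave of the trace (\<open>integral_square_le_trace_defect\<close>). The projection onto the
  eigenfunctions with the largest eigenvalues then gives the upper bound (\<open>projection_error\<close>), and a
  combination of eigenfunctions that is annihilated by all given functionals gives the lower bound
  (\<open>exists_in_kernel_of_functionals\<close>).

  The concrete part supplies the eigenfunctions. For \<open>\<gamma>\<^sup>2 = a + a\<^sup>2\<close> one has \<open>\<omega> = a / (1 + a)\<close>, and
  completing the square turns the one-dimensional operator, conjugated with \<open>exp (- a * x\<^sup>2)\<close>, into
  the Mehler semigroup \<open>p \<mapsto> E p(\<omega> t + (1 - \<omega>) Y)\<close>, \<open>Y\<close> a Gaussian variable, acting on polynomials. It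
  multiplies the \<open>k\<close>-th rescaled Hermite polynomial by \<open>\<omega> ^ k\<close> (\<open>gauss_mean_hermite\<close>). Tensor
  products settle the case of \<open>d\<close> variables, and the trace condition becomes
  \<open>(\<Sum>k. (1 - \<omega>) * \<omega> ^ k) ^ d = 1\<close>.
\<close>

section \<open>Hilbert spaces of functions and the Riesz representation theorem\<close>

context function_hilbert_space
begin

lemma lin_closed: "f \<in> H \<Longrightarrow> g \<in> H \<Longrightarrow> (\<lambda>x. a * f x + b * g x) \<in> H"
  by (intro add_closed scale_closed)

lemma diff_closed: "f \<in> H \<Longrightarrow> g \<in> H \<Longrightarrow> (\<lambda>x. f x - g x) \<in> H"
  using lin_closed[of f g 1 "-1"] by simp

lemma sum_closed: "finite A \<Longrightarrow> (\<And>i. i \<in> A \<Longrightarrow> F i \<in> H) \<Longrightarrow> (\<lambda>x. \<Sum>i\<in>A. c i * F i x) \<in> H"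
  by (induction A rule: finite_induct) (auto intro!: zero_closed add_closed scale_closed)

lemma ip_lin_left:
  "f \<in> H \<Longrightarrow> g \<in> H \<Longrightarrow> h \<in> H \<Longrightarrow> ip (\<lambda>x. a * f x + b * g x) h = a * ip f h + b * ip g h"
  by (simp add: ip_add_left scale_closed ip_scale_left)

lemma ip_diff_left:
  "f \<in> H \<Longrightarrow> g \<in> H \<Longrightarrow> h \<in> H \<Longrightarrow> ip (\<lambda>x. f x - g x) h = ip f h - ip g h"
  using ip_lin_left[of f g h 1 "-1"] by simp

lemma ip_zero_left: "g \<in> H \<Longrightarrow> ip (\<lambda>x. 0) g = 0"
  using ip_scale_left[of g g 0] by simp

lemma ip_sum_left:
  "finite A \<Longrightarrow> (\<And>i. i \<in> A \<Longrightarrow> F i \<in> H) \<Longrightarrow> g \<in> H \<Longrightarrow>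
    ip (\<lambda>x. \<Sum>i\<in>A. c i * F i x) g = (\<Sum>i\<in>A. c i * ip (F i) g)"
proof (induction A rule: finite_induct)
  case (insert a A)
  have "ip (\<lambda>x. c a * F a x + (\<Sum>i\<in>A. c i * F i x)) g
      = ip (\<lambda>x. c a * F a x) g + ip (\<lambda>x. \<Sum>i\<in>A. c i * F i x) g"
    using insert by (intro ip_add_left scale_closed sum_closed) auto
  then show ?case using insert by (simp add: ip_scale_left)
qed (simp add: ip_zero_left)

lemma ip_lin_self:
  assumes "f \<in> H" "g \<in> H"
  shows "ip (\<lambda>x. a * f x + b * g x) (\<lambda>x. a * f x + b * g x)
    = a\<^sup>2 * ip f f + 2 * a * b * ip f g + b\<^sup>2 * ip g g"
proof -
  let ?k = "\<lambda>x. a * f x + b * g x"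
  have k: "?k \<in> H" using assms by (rule lin_closed)
  have "ip ?k ?k = a * ip f ?k + b * ip g ?k"
    using assms k by (intro ip_lin_left)
  also have "ip f ?k = a * ip f f + b * ip g f"
    using ip_lin_left[OF assms assms(1), of a b] ip_commute[OF assms(1) k] by simp
  also have "ip g ?k = a * ip f g + b * ip g g"
    using ip_lin_left[OF assms assms(2), of a b] ip_commute[OF assms(2) k] by simp
  also have "ip g f = ip f g" using assms ip_commute by blast
  finally show ?thesis by (simp add: algebra_simps power2_eq_square)
qed

lemma ip_diff_self:
  assumes "f \<in> H" "g \<in> H"
  shows "ip (\<lambda>x. f x - g x) (\<lambda>x. f x - g x) = ip f f - 2 * ip f g + ip g g"
  using ip_lin_self[OF assms, of 1 "-1"] by simp

lemma cauchy_schwarz: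
  assumes f: "f \<in> H" and g: "g \<in> H"
  shows "(ip f g)\<^sup>2 \<le> ip f f * ip g g"
proof (cases "ip g g = 0")
  case True
  then have "ip f g = 0"
    using f g ip_definite[OF g] ip_zero_left ip_commute by metis
  then show ?thesis using True by simp
next
  case False
  then have pos: "ip g g > 0" using ip_nonneg[OF g] by simp
  define t where "t = ip f g / ip g g"
  have "0 \<le> ip (\<lambda>x. 1 * f x + (-t) * g x) (\<lambda>x. 1 * f x + (-t) * g x)"
    using f g by (intro ip_nonneg lin_closed)
  also have "\<dots> = ip f f - 2 * t * ip f g + t\<^sup>2 * ip g g"
    using ip_lin_self[OF f g, of 1 "-t"] by simp
  also have "\<dots> = ip f f - (ip f g)\<^sup>2 / ip g g"
    using pos unfolding t_def by (simp add: field_simps power2_eq_square)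
  finally show ?thesis using pos by (simp add: field_simps)
qed

lemma hnorm_square: "f \<in> H \<Longrightarrow> (hnorm ip f)\<^sup>2 = ip f f"
  by (simp add: hnorm_def ip_nonneg)

lemma abs_ip_le: "f \<in> H \<Longrightarrow> g \<in> H \<Longrightarrow> \<bar>ip f g\<bar> \<le> hnorm ip f * hnorm ip g"
  unfolding hnorm_def using cauchy_schwarz[of f g]
  by (metis real_sqrt_abs real_sqrt_le_iff real_sqrt_mult)

text \<open>
  The representer is the minimiser of \<open>f \<mapsto> ip f f - 2 * l f\<close>. By the parallelogram law every
  minimising sequence is Cauchy, and the first variation at the limit says \<open>l f = ip f h\<close>.
\<close>

lemma riesz_representation:
  assumes l_add: "\<And>f g. f \<in> H \<Longrightarrow> g \<in> H \<Longrightarrow> l (\<lambda>x. f x + g x) = l f + l g"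
    and l_scale: "\<And>c f. f \<in> H \<Longrightarrow> l (\<lambda>x. c * f x) = c * l f"
    and l_bound: "\<And>f. f \<in> H \<Longrightarrow> \<bar>l f\<bar> \<le> C * hnorm ip f"
  obtains h where "h \<in> H" "\<And>f. f \<in> H \<Longrightarrow> l f = ip f h"
proof -
  define J where "J f = ip f f - 2 * l f" for f
  have l_lin: "l (\<lambda>x. a * f x + b * g x) = a * l f + b * l g" if "f \<in> H" "g \<in> H" for f g a b
    using that by (simp add: l_add l_scale scale_closed)
  have J_lin: "J (\<lambda>x. a * f x + b * g x)
      = a\<^sup>2 * ip f f + 2 * a * b * ip f g + b\<^sup>2 * ip g g - 2 * a * l f - 2 * b * l g"
    if "f \<in> H" "g \<in> H" for f g a b
    using that by (simp add: J_def ip_lin_self l_lin)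
  have J_bound: "- (C\<^sup>2) \<le> J f" if "f \<in> H" for f
  proof -
    have "2 * l f \<le> 2 * (C * hnorm ip f)" using l_bound[OF that] by linarith
    also have "\<dots> \<le> C\<^sup>2 + ip f f"
      using hnorm_square[OF that] sum_squares_bound[of C "hnorm ip f"] by simp
    finally show ?thesis by (simp add: J_def)
  qed
  define m where "m = Inf (J ` H)"
  have bdd: "bdd_below (J ` H)" using J_bound by (intro bdd_belowI2)
  have m_le: "m \<le> J f" if "f \<in> H" for f
    unfolding m_def using bdd that by (simp add: cInf_lower)
  have "\<exists>f\<in>H. J f < m + 1 / Suc n" for n :: nat
    using cInf_lessD[of "J ` H" "m + 1 / Suc n"] zero_closed by (force simp: m_def)
  then obtain F where F: "\<And>n. F n \<in> H" and JF: "\<And>n::nat. J (F n) < m + 1 / Suc n" by metis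
  \<comment> \<open>The functional at the midpoint of two near-minimisers is at least \<open>m\<close>, which forces them to be close.\<close>
  have cauchy: "ip (\<lambda>x. F i x - F j x) (\<lambda>x. F i x - F j x) \<le> 4 / Suc k"
    if "k \<le> i" "k \<le> j" for i j k :: nat
  proof -
    have "m \<le> J (\<lambda>x. (1/2) * F i x + (1/2) * F j x)" using F by (intro m_le lin_closed)
    then have "ip (\<lambda>x. F i x - F j x) (\<lambda>x. F i x - F j x) \<le> 2 * (J (F i) + J (F j) - 2 * m)"
      using F by (subst (asm) J_lin) (simp_all add: ip_diff_self J_def power2_eq_square)
    moreover have "1 / Suc i \<le> 1 / Suc k" "1 / Suc j \<le> 1 / Suc k"
      using that by (simp_all add: frac_le)
    ultimately show ?thesis using JF[of i] JF[of j] by simp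
  qed
  have "\<exists>h\<in>H. (\<lambda>n. hnorm ip (\<lambda>x. F n x - h x)) \<longlonglongrightarrow> 0"
  proof (rule complete)
    fix e :: real assume "0 < e"
    then obtain M :: nat where M: "4 / Suc M < e\<^sup>2"
      using nat_approx_posE[of "e\<^sup>2 / 4"] by (auto simp: field_simps)
    have "hnorm ip (\<lambda>x. F i x - F j x) < e" if "M \<le> i" "M \<le> j" for i j
      using cauchy[OF that] M \<open>0 < e\<close> unfolding hnorm_def
      by (intro real_less_lsqrt) auto
    then show "\<exists>M. \<forall>m\<ge>M. \<forall>n\<ge>M. hnorm ip (\<lambda>x. F m x - F n x) < e" by blast
  qed (rule F)
  then obtain h where h: "h \<in> H" and lim: "(\<lambda>n. hnorm ip (\<lambda>x. F n x - h x)) \<longlonglongrightarrow> 0" by blast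
  have J_le: "J h \<le> m + 1 / Suc n + 2 * (hnorm ip h + C) * hnorm ip (\<lambda>x. F n x - h x)" for n
  proof -
    let ?g = "\<lambda>x. F n x - h x"
    have g: "?g \<in> H" using F h by (rule diff_closed)
    have "J h \<le> J (F n) + 2 * \<bar>ip ?g h\<bar> + 2 * \<bar>l ?g\<bar>"
    proof -
      have "l ?g = l (F n) - l h" using l_lin[OF F h, where a = 1 and b = "-1"] by simp
      moreover have "ip ?g h = ip (F n) h - ip h h" using F h by (simp add: ip_diff_left)
      ultimately show ?thesis
        using ip_nonneg[OF g] ip_diff_self[OF F[of n] h] unfolding J_def by linarith
    qed
    then show ?thesis
      using abs_ip_le[OF g h] l_bound[OF g] JF[of n] by (simp add: algebra_simps)
  qed
  have "(\<lambda>n::nat. m + 1 / Suc n + 2 * (hnorm ip h + C) * hnorm ip (\<lambda>x. F n x - h x)) \<longlonglongrightarrow>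
      m + 0 + 2 * (hnorm ip h + C) * 0"
    using LIMSEQ_inverse_real_of_nat by (intro tendsto_intros lim) (simp add: inverse_eq_divide)
  then have Jh: "J h \<le> m" using J_le by (intro LIMSEQ_le_const) auto
  have "l f = ip f h" if f: "f \<in> H" for f
  proof -
    define p where "p = ip h f - l f"
    have q: "0 \<le> t\<^sup>2 * ip f f + 2 * t * p" for t
      using m_le[OF lin_closed[OF h f, where a = 1 and b = t]] J_lin[OF h f, where a = 1 and b = t] Jh
      by (simp add: J_def p_def algebra_simps)
    have "p = 0"
    proof (cases "ip f f = 0")
      case True
      then show ?thesis using q[of "-p"] by (simp flip: power2_eq_square)
    next
      case False
      then have pos: "ip f f > 0" using ip_nonneg[OF f] by simp
      have "0 \<le> - (p\<^sup>2 / ip f f)"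
        using q[of "- p / ip f f"] pos by (simp add: field_simps power2_eq_square)
      then show ?thesis using pos by (simp add: divide_le_0_iff not_less)
    qed
    then show ?thesis using ip_commute[OF h f] by (simp add: p_def)
  qed
  with h show ?thesis by (rule that)
qed

end

section \<open>Homogeneous linear systems\<close>

text \<open>
  Gaussian elimination on the last equation: a pivot \<open>p\<close> with nonzero coefficient is eliminated from
  the other equations, and its value is recovered from the solution of the reduced system.
\<close>

lemma homogeneous_system_nontrivial:
  fixes a :: "nat \<Rightarrow> 'k \<Rightarrow> real"
  assumes "finite I" "n < card I"
  shows "\<exists>x. (\<exists>k\<in>I. x k \<noteq> 0) \<and> (\<forall>i\<in>{1..n}. (\<Sum>k\<in>I. x k * a i k) = 0)"
  using assms
proof (induction n arbitrary: I a)
  case 0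
  then have "I \<noteq> {}" by auto
  then show ?case by (intro exI[of _ "\<lambda>_. 1"]) auto
next
  case (Suc n)
  show ?case
  proof (cases "\<forall>k\<in>I. a (Suc n) k = 0")
    case True
    obtain x where x: "\<exists>k\<in>I. x k \<noteq> 0" "\<forall>i\<in>{1..n}. (\<Sum>k\<in>I. x k * a i k) = 0"
      using Suc.IH[of I a] Suc.prems by auto
    have "(\<Sum>k\<in>I. x k * a i k) = 0" if "i \<in> {1..Suc n}" for i
      using that x(2) True by (cases "i = Suc n") auto
    then show ?thesis using x(1) by blast
  next
    case False
    then obtain p where p: "p \<in> I" "a (Suc n) p \<noteq> 0" by blast
    define b where "b i k = a i k - a i p * a (Suc n) k / a (Suc n) p" for i k
    have "n < card (I - {p})" using Suc.prems p by simp
    then obtain x where x: "\<exists>k\<in>I-{p}. x k \<noteq> 0"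
      and sol: "\<forall>i\<in>{1..n}. (\<Sum>k\<in>I-{p}. x k * b i k) = 0"
      using Suc.IH[of "I - {p}" b] Suc.prems(1) by auto
    define s where "s = (\<Sum>k\<in>I-{p}. x k * a (Suc n) k)"
    define y where "y = x(p := - s / a (Suc n) p)"
    have y_sum: "(\<Sum>k\<in>I. y k * a i k) = (\<Sum>k\<in>I-{p}. x k * a i k) - s / a (Suc n) p * a i p" for i
    proof -
      have "(\<Sum>k\<in>I-{p}. y k * a i k) = (\<Sum>k\<in>I-{p}. x k * a i k)"
        by (intro sum.cong) (auto simp: y_def)
      then show ?thesis
        using sum.remove[OF Suc.prems(1) p(1), of "\<lambda>k. y k * a i k"] by (simp add: y_def)
    qed
    have "(\<Sum>k\<in>I. y k * a i k) = 0" if i: "i \<in> {1..Suc n}" for i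
    proof (cases "i = Suc n")
      case True
      then show ?thesis using p(2) by (simp add: y_sum flip: s_def)
    next
      case False
      then have "(\<Sum>k\<in>I-{p}. x k * b i k) = 0" using i sol by auto
      moreover have "(\<Sum>k\<in>I-{p}. x k * b i k)
          = (\<Sum>k\<in>I-{p}. x k * a i k) - s / a (Suc n) p * a i p"
        by (simp add: b_def s_def sum_distrib_left sum_distrib_right sum_divide_distrib
            right_diff_distrib sum_subtractf mult_ac)
      ultimately show ?thesis by (simp add: y_sum)
    qed
    moreover have "\<exists>k\<in>I. y k \<noteq> 0" using x unfolding y_def by (metis DiffE fun_upd_other singletonI)
    ultimately show ?thesis by blast
  qed
qed


section \<open>Eigenfunctions and approximation in a reproducing kernel Hilbert space\<close>

lemma integrable_mult_of_squares:
  fixes f g :: "'a \<Rightarrow> real"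
  assumes [measurable]: "f \<in> borel_measurable M" "g \<in> borel_measurable M"
    and "integrable M (\<lambda>x. (f x)\<^sup>2)" "integrable M (\<lambda>x. (g x)\<^sup>2)"
  shows "integrable M (\<lambda>x. f x * g x)"
proof (rule Bochner_Integration.integrable_bound)
  show "integrable M (\<lambda>x. (f x)\<^sup>2 + (g x)\<^sup>2)" using assms by auto
  have "\<bar>a * b\<bar> \<le> a\<^sup>2 + b\<^sup>2" for a b :: real
    using sum_squares_bound[of a b] sum_squares_bound[of a "-b"] zero_le_power2[of a]
      zero_le_power2[of b] unfolding power2_minus by (simp only: abs_le_iff) linarith
  then show "AE x in M. norm (f x * g x) \<le> norm ((f x)\<^sup>2 + (g x)\<^sup>2)"
    by simp
qed simp

text \<open>
  Integrability of the diagonal makes \<open>H\<close> embed into \<open>L\<^sub>2\<close>, with \<open>(f x)\<^sup>2 \<le> ip f f * K x x\<close> as the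
  pointwise source of the bound; the integral of the diagonal is the trace of the operator.
\<close>

locale rkhs_L2 = rkhs X H ip K
  for X :: "'x set" and H :: "('x \<Rightarrow> real) set" and ip K +
  fixes M :: "'x measure"
  assumes space_M: "space M = X"
    and H_measurable: "f \<in> H \<Longrightarrow> f \<in> borel_measurable M"
    and integrable_diag: "integrable M (\<lambda>x. K x x)"
begin

definition section_at :: "'x \<Rightarrow> 'x \<Rightarrow> real" where
  "section_at s = (\<lambda>t. if t \<in> X then K t s else 0)"

lemma section_at_mem: "s \<in> X \<Longrightarrow> section_at s \<in> H"
  unfolding section_at_def by (rule kernel_mem)

lemma ip_section_at: "s \<in> X \<Longrightarrow> f \<in> H \<Longrightarrow> ip f (section_at s) = f s"
  unfolding section_at_def by (rule reproducing)

lemma ip_section_at_self: "s \<in> X \<Longrightarrow> ip (section_at s) (section_at s) = K s s"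
  by (simp add: ip_section_at section_at_mem) (simp add: section_at_def)

lemma kernel_commute: "s \<in> X \<Longrightarrow> t \<in> X \<Longrightarrow> K s t = K t s"
  using ip_section_at[of s "section_at t"] ip_section_at[of t "section_at s"]
    ip_commute[OF section_at_mem section_at_mem] by (simp add: section_at_mem) (simp add: section_at_def)

lemma diag_nonneg: "s \<in> X \<Longrightarrow> 0 \<le> K s s"
  using ip_nonneg[OF section_at_mem] ip_section_at_self by metis

lemma square_le_diag: "f \<in> H \<Longrightarrow> x \<in> X \<Longrightarrow> (f x)\<^sup>2 \<le> ip f f * K x x"
  using cauchy_schwarz[of f "section_at x"]
  by (simp add: section_at_mem ip_section_at_self) (simp add: ip_section_at)

lemma integrable_square: "f \<in> H \<Longrightarrow> integrable M (\<lambda>x. (f x)\<^sup>2)"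
proof (rule Bochner_Integration.integrable_bound)
  assume f: "f \<in> H"
  show "integrable M (\<lambda>x. ip f f * K x x)" using integrable_diag by simp
  show "(\<lambda>x. (f x)\<^sup>2) \<in> borel_measurable M" using H_measurable[OF f] by measurable
  have "(f x)\<^sup>2 \<le> \<bar>ip f f * K x x\<bar>" if "x \<in> X" for x
    using square_le_diag[OF f that] by linarith
  then show "AE x in M. norm ((f x)\<^sup>2) \<le> norm (ip f f * K x x)"
    by (intro AE_I2) (simp add: space_M)
qed

lemma integral_square_le:
  assumes "f \<in> H"
  shows "(LINT x|M. (f x)\<^sup>2) \<le> ip f f * (LINT x|M. K x x)"
proof -
  have "(LINT x|M. (f x)\<^sup>2) \<le> (LINT x|M. ip f f * K x x)"
    using integrable_square[OF assms] integrable_diag square_le_diag[OF assms]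
    by (intro integral_mono) (auto simp: space_M)
  then show ?thesis by simp
qed

text \<open>
  The functional \<open>f \<mapsto> \<integral> f \<phi>\<close> is bounded on \<open>H\<close>. Evaluating its representer with the reproducing
  property at \<open>t\<close> gives \<open>\<integral> K(t, s) \<phi>(s)\<close>, so the representer is \<open>\<mu>\<close> times \<open>\<phi>\<close>. This gives membership in
  \<open>H\<close> and the value of the inner product at once.
\<close>

lemma eigenfunction_mem:
  assumes [measurable]: "\<phi> \<in> borel_measurable M" and sq: "integrable M (\<lambda>x. (\<phi> x)\<^sup>2)"
    and supp: "\<And>x. x \<notin> X \<Longrightarrow> \<phi> x = 0" and "\<mu> \<noteq> 0"
    and eigen: "\<And>t. t \<in> X \<Longrightarrow> (LINT s|M. K t s * \<phi> s) = \<mu> * \<phi> t"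
  shows "\<phi> \<in> H \<and> (\<forall>f\<in>H. ip f \<phi> = (LINT x|M. f x * \<phi> x) / \<mu>)"
proof -
  have integrable: "integrable M (\<lambda>x. f x * \<phi> x)" if "f \<in> H" for f
    using integrable_mult_of_squares[OF H_measurable[OF that] assms(1) integrable_square[OF that] sq] .
  have meas_diag: "(\<lambda>x. sqrt (K x x)) \<in> borel_measurable M"
    using borel_measurable_integrable[OF integrable_diag] by measurable
  have "integrable M (\<lambda>x. (sqrt (K x x))\<^sup>2)"
    using integrable_diag diag_nonneg
    by (subst Bochner_Integration.integrable_cong[where g = "\<lambda>x. K x x"]) (auto simp: space_M)
  then have int: "integrable M (\<lambda>x. sqrt (K x x) * \<bar>\<phi> x\<bar>)"
    using sq meas_diag by (intro integrable_mult_of_squares) auto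
  define C where "C = (LINT x|M. sqrt (K x x) * \<bar>\<phi> x\<bar>)"
  have bound: "\<bar>LINT x|M. f x * \<phi> x\<bar> \<le> C * hnorm ip f" if f: "f \<in> H" for f
  proof -
    have "\<bar>f x\<bar> \<le> hnorm ip f * sqrt (K x x)" if "x \<in> X" for x
      using square_le_diag[OF f that] unfolding hnorm_def
      by (metis real_sqrt_abs real_sqrt_le_iff real_sqrt_mult)
    then have "\<bar>f x * \<phi> x\<bar> \<le> hnorm ip f * (sqrt (K x x) * \<bar>\<phi> x\<bar>)" if "x \<in> X" for x
      using that mult_right_mono[of "\<bar>f x\<bar>" "hnorm ip f * sqrt (K x x)" "\<bar>\<phi> x\<bar>"]
      by (simp add: abs_mult mult.assoc)
    then have "(LINT x|M. \<bar>f x * \<phi> x\<bar>) \<le> (LINT x|M. hnorm ip f * (sqrt (K x x) * \<bar>\<phi> x\<bar>))"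
      using integrable[OF f] int by (intro integral_mono) (auto simp: space_M)
    from order_trans[OF integral_abs_bound this] show ?thesis by (simp add: C_def mult.commute)
  qed
  obtain h where h: "h \<in> H" and rep: "\<And>f. f \<in> H \<Longrightarrow> (LINT x|M. f x * \<phi> x) = ip f h"
  proof (rule riesz_representation[of "\<lambda>f. LINT x|M. f x * \<phi> x" C])
    show "(LINT x|M. (f x + g x) * \<phi> x) = (LINT x|M. f x * \<phi> x) + (LINT x|M. g x * \<phi> x)"
      if "f \<in> H" "g \<in> H" for f g
      using integrable that by (simp add: distrib_right)
    show "(LINT x|M. c * f x * \<phi> x) = c * (LINT x|M. f x * \<phi> x)" for c f
      by (simp add: mult.assoc)
  qed (use bound in auto)
  have h_eq: "h = (\<lambda>t. \<mu> * \<phi> t)"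
  proof
    fix t
    show "h t = \<mu> * \<phi> t"
    proof (cases "t \<in> X")
      case True
      have "h t = (LINT s|M. section_at t s * \<phi> s)"
        using True h rep[of "section_at t"] ip_commute[of h "section_at t"]
        by (simp add: section_at_mem ip_section_at)
      also have "\<dots> = (LINT s|M. K t s * \<phi> s)"
        using True by (intro Bochner_Integration.integral_cong)
          (auto simp: section_at_def space_M kernel_commute)
      finally show ?thesis using eigen[OF True] by simp
    qed (use supp function_hilbert_space.supp[OF function_hilbert_space_axioms h] in auto)
  qed
  have \<phi>_eq: "\<phi> = (\<lambda>t. (1 / \<mu>) * h t)" using \<open>\<mu> \<noteq> 0\<close> by (simp add: h_eq)
  have \<phi>: "\<phi> \<in> H" by (subst \<phi>_eq) (rule scale_closed[OF h])
  have "ip f \<phi> = (LINT x|M. f x * \<phi> x) / \<mu>" if f: "f \<in> H" for f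
  proof -
    have "ip \<phi> f = (1 / \<mu>) * ip h f" by (subst \<phi>_eq) (rule ip_scale_left[OF h f])
    then show ?thesis using ip_commute f h \<phi> rep by simp
  qed
  with \<phi> show ?thesis by blast
qed

end

text \<open>
  The last assumption replaces completeness of the eigenfunctions: the eigenvalues exhaust the
  trace.
\<close>

locale rkhs_eigensystem = rkhs_L2 X H ip K M
  for X :: "'x set" and H :: "('x \<Rightarrow> real) set" and ip K M +
  fixes L :: "'k set" and \<phi> :: "'k \<Rightarrow> 'x \<Rightarrow> real" and lam :: "'k \<Rightarrow> real"
  assumes \<phi>_measurable: "k \<in> L \<Longrightarrow> \<phi> k \<in> borel_measurable M"
    and \<phi>_integrable_square: "k \<in> L \<Longrightarrow> integrable M (\<lambda>x. (\<phi> k x)\<^sup>2)"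
    and \<phi>_supp: "k \<in> L \<Longrightarrow> x \<notin> X \<Longrightarrow> \<phi> k x = 0"
    and lam_pos: "k \<in> L \<Longrightarrow> 0 < lam k"
    and eigen: "k \<in> L \<Longrightarrow> t \<in> X \<Longrightarrow> (LINT s|M. K t s * \<phi> k s) = lam k * \<phi> k t"
    and orthonormal:
      "k \<in> L \<Longrightarrow> j \<in> L \<Longrightarrow> (LINT x|M. \<phi> k x * \<phi> j x) = (if k = j then 1 else 0)"
    and trace: "0 < e \<Longrightarrow> \<exists>J\<subseteq>L. finite J \<and> (LINT x|M. K x x) - e < sum lam J"
begin

definition coef :: "('x \<Rightarrow> real) \<Rightarrow> 'k \<Rightarrow> real" where
  "coef f k = (LINT x|M. f x * \<phi> k x)"

definition proj :: "'k set \<Rightarrow> ('x \<Rightarrow> real) \<Rightarrow> 'x \<Rightarrow> real" where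
  "proj I f = (\<lambda>x. \<Sum>k\<in>I. coef f k * \<phi> k x)"

lemma \<phi>_eigenfunction:
  assumes "k \<in> L"
  shows "\<phi> k \<in> H \<and> (\<forall>f\<in>H. ip f (\<phi> k) = coef f k / lam k)"
  unfolding coef_def using assms lam_pos[OF assms]
  by (intro eigenfunction_mem \<phi>_measurable \<phi>_integrable_square \<phi>_supp eigen) auto

lemma \<phi>_mem: "k \<in> L \<Longrightarrow> \<phi> k \<in> H"
  using \<phi>_eigenfunction by blast

lemma ip_\<phi>: "k \<in> L \<Longrightarrow> f \<in> H \<Longrightarrow> ip f (\<phi> k) = coef f k / lam k"
  using \<phi>_eigenfunction by blast

lemma coef_eq: "k \<in> L \<Longrightarrow> f \<in> H \<Longrightarrow> coef f k = lam k * ip f (\<phi> k)"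
  using ip_\<phi> lam_pos by (force simp: field_simps)

lemma comb_mem: "finite I \<Longrightarrow> I \<subseteq> L \<Longrightarrow> (\<lambda>x. \<Sum>k\<in>I. c k * \<phi> k x) \<in> H"
  by (intro sum_closed \<phi>_mem) auto

lemma coef_comb:
  assumes "finite I" "I \<subseteq> L" "j \<in> L"
  shows "coef (\<lambda>x. \<Sum>k\<in>I. c k * \<phi> k x) j = (if j \<in> I then c j else 0)"
proof -
  have "integrable M (\<lambda>x. c k * (\<phi> k x * \<phi> j x))" if "k \<in> I" for k
    using assms that
    by (intro integrable_mult_right integrable_mult_of_squares \<phi>_measurable \<phi>_integrable_square) auto
  then have "coef (\<lambda>x. \<Sum>k\<in>I. c k * \<phi> k x) j = (\<Sum>k\<in>I. c k * (LINT x|M. \<phi> k x * \<phi> j x))"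
    unfolding coef_def sum_distrib_right mult.assoc by (subst Bochner_Integration.integral_sum) auto
  also have "\<dots> = (\<Sum>k\<in>I. if k = j then c k else 0)"
    using assms by (intro sum.cong) (auto simp: orthonormal subset_iff)
  finally show ?thesis using assms by simp
qed

lemma ip_comb:
  assumes "finite I" "I \<subseteq> L" "f \<in> H"
  shows "ip f (\<lambda>x. \<Sum>k\<in>I. c k * \<phi> k x) = (\<Sum>k\<in>I. c k * coef f k / lam k)"
proof -
  have "ip f (\<lambda>x. \<Sum>k\<in>I. c k * \<phi> k x) = (\<Sum>k\<in>I. c k * ip (\<phi> k) f)"
    using assms by (subst ip_commute) (auto intro!: comb_mem ip_sum_left \<phi>_mem)
  also have "\<dots> = (\<Sum>k\<in>I. c k * coef f k / lam k)"
  proof (intro sum.cong refl)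
    fix k assume "k \<in> I"
    then have "k \<in> L" using assms by blast
    then show "c k * ip (\<phi> k) f = c k * coef f k / lam k"
      using assms ip_commute[OF \<phi>_mem, of k f] ip_\<phi>[of k f] by simp
  qed
  finally show ?thesis .
qed

lemma integral_mult_comb:
  assumes "finite I" "I \<subseteq> L" "f \<in> H"
  shows "(LINT x|M. f x * (\<Sum>k\<in>I. c k * \<phi> k x)) = (\<Sum>k\<in>I. c k * coef f k)"
proof -
  have "integrable M (\<lambda>x. c k * (f x * \<phi> k x))" if "k \<in> I" for k
    using assms that
    by (intro integrable_mult_right integrable_mult_of_squares \<phi>_measurable \<phi>_integrable_square
        H_measurable integrable_square) auto
  then show ?thesis
    unfolding coef_def sum_distrib_left mult.left_commute[of "f _"]
    by (subst Bochner_Integration.integral_sum) auto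
qed

lemma integral_comb_square:
  assumes "finite I" "I \<subseteq> L"
  shows "(LINT x|M. (\<Sum>k\<in>I. c k * \<phi> k x)\<^sup>2) = (\<Sum>k\<in>I. (c k)\<^sup>2)"
  unfolding power2_eq_square using assms
  by (subst integral_mult_comb) (auto intro!: comb_mem sum.cong simp: coef_comb subset_iff)

lemma ip_comb_self:
  assumes "finite I" "I \<subseteq> L"
  shows "ip (\<lambda>x. \<Sum>k\<in>I. c k * \<phi> k x) (\<lambda>x. \<Sum>k\<in>I. c k * \<phi> k x) = (\<Sum>k\<in>I. (c k)\<^sup>2 / lam k)"
  unfolding power2_eq_square using assms
  by (subst ip_comb) (auto intro!: comb_mem sum.cong simp: coef_comb subset_iff)

lemma proj_mem: "finite I \<Longrightarrow> I \<subseteq> L \<Longrightarrow> proj I f \<in> H"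
  unfolding proj_def by (rule comb_mem)

lemma residual_mem: "finite I \<Longrightarrow> I \<subseteq> L \<Longrightarrow> f \<in> H \<Longrightarrow> (\<lambda>x. f x - proj I f x) \<in> H"
  by (intro diff_closed proj_mem)

lemma integral_residual_square:
  assumes I: "finite I" "I \<subseteq> L" and f: "f \<in> H"
  shows "(LINT x|M. (f x - proj I f x)\<^sup>2) = (LINT x|M. (f x)\<^sup>2) - (\<Sum>k\<in>I. (coef f k)\<^sup>2)"
proof -
  note p = proj_mem[OF I, of f]
  have int: "integrable M (\<lambda>x. f x * proj I f x)"
    using f p by (intro integrable_mult_of_squares H_measurable integrable_square)
  have "(LINT x|M. (f x - proj I f x)\<^sup>2)
      = (LINT x|M. (f x)\<^sup>2 - 2 * (f x * proj I f x) + (proj I f x)\<^sup>2)"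
    by (intro Bochner_Integration.integral_cong) (simp_all add: power2_diff)
  also have "\<dots> = (LINT x|M. (f x)\<^sup>2) - 2 * (LINT x|M. f x * proj I f x) + (LINT x|M. (proj I f x)\<^sup>2)"
    using int integrable_square[OF f] integrable_square[OF p] by simp
  also have "(LINT x|M. f x * proj I f x) = (\<Sum>k\<in>I. (coef f k)\<^sup>2)"
    unfolding proj_def by (subst integral_mult_comb[OF I f]) (simp add: power2_eq_square)
  also have "(LINT x|M. (proj I f x)\<^sup>2) = (\<Sum>k\<in>I. (coef f k)\<^sup>2)"
    unfolding proj_def by (rule integral_comb_square[OF I])
  finally show ?thesis by simp
qed

lemma ip_residual_self:
  assumes I: "finite I" "I \<subseteq> L" and f: "f \<in> H"
  shows "ip (\<lambda>x. f x - proj I f x) (\<lambda>x. f x - proj I f x) = ip f f - (\<Sum>k\<in>I. (coef f k)\<^sup>2 / lam k)"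
proof -
  have "ip f (proj I f) = (\<Sum>k\<in>I. (coef f k)\<^sup>2 / lam k)"
    unfolding proj_def by (subst ip_comb[OF I f]) (simp add: power2_eq_square)
  moreover have "ip (proj I f) (proj I f) = (\<Sum>k\<in>I. (coef f k)\<^sup>2 / lam k)"
    unfolding proj_def by (rule ip_comb_self[OF I])
  ultimately show ?thesis using ip_diff_self[OF f proj_mem[OF I]] by simp
qed

lemma bessel:
  assumes "finite I" "I \<subseteq> L" "f \<in> H"
  shows "(\<Sum>k\<in>I. (coef f k)\<^sup>2 / lam k) \<le> ip f f"
  using ip_nonneg[OF residual_mem[OF assms]] ip_residual_self[OF assms] by simp

text \<open>
  The reproducing property of \<open>g\<close> is applied not with the section of the kernel at \<open>x\<close> but with its
  residual after projection onto the \<open>\<phi> k\<close>, which changes nothing because \<open>g\<close> is orthogonal to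
  them.
\<close>

lemma square_le_diag_defect:
  assumes I: "finite I" "I \<subseteq> L" and g: "g \<in> H" and orth: "\<And>k. k \<in> I \<Longrightarrow> coef g k = 0"
    and x: "x \<in> X"
  shows "(g x)\<^sup>2 \<le> ip g g * (K x x - (\<Sum>k\<in>I. lam k * (\<phi> k x)\<^sup>2))"
proof -
  let ?s = "section_at x"
  let ?r = "\<lambda>t. ?s t - proj I ?s t"
  have s: "?s \<in> H" using x by (rule section_at_mem)
  have coef_s: "coef ?s k = lam k * \<phi> k x" if "k \<in> I" for k
    using that I s x ip_commute[OF s \<phi>_mem, of k] by (simp add: coef_eq ip_section_at \<phi>_mem subset_iff)
  have "ip g ?r = ip g ?s - ip g (proj I ?s)"
    using ip_diff_left[OF s proj_mem[OF I] g, of ?s] ip_commute[OF g]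
      residual_mem[OF I s] proj_mem[OF I] s by simp
  also have "ip g (proj I ?s) = 0"
    unfolding proj_def by (subst ip_comb[OF I g]) (simp add: orth)
  finally have gr: "ip g ?r = g x" using ip_section_at[OF x g] by simp
  have "ip ?r ?r = K x x - (\<Sum>k\<in>I. (coef ?s k)\<^sup>2 / lam k)"
    using ip_residual_self[OF I s] ip_section_at_self[OF x] by simp
  also have "(\<Sum>k\<in>I. (coef ?s k)\<^sup>2 / lam k) = (\<Sum>k\<in>I. lam k * (\<phi> k x)\<^sup>2)"
    using I lam_pos by (intro sum.cong) (force simp: coef_s power2_eq_square)+
  finally show ?thesis using cauchy_schwarz[OF g residual_mem[OF I s]] gr by simp
qed

text \<open>
  Integrating the pointwise bound. This is where the trace controls the part of \<open>H\<close> that is not yet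
  reached by the eigenfunctions.
\<close>

lemma integral_square_le_trace_defect:
  assumes I: "finite I" "I \<subseteq> L" and g: "g \<in> H" and orth: "\<And>k. k \<in> I \<Longrightarrow> coef g k = 0"
  shows "(LINT x|M. (g x)\<^sup>2) \<le> ip g g * ((LINT x|M. K x x) - sum lam I)"
proof -
  have int: "integrable M (\<lambda>x. \<Sum>k\<in>I. lam k * (\<phi> k x)\<^sup>2)"
    using I by (intro Bochner_Integration.integrable_sum integrable_mult_right \<phi>_integrable_square) auto
  have "(LINT x|M. (g x)\<^sup>2) \<le> (LINT x|M. ip g g * (K x x - (\<Sum>k\<in>I. lam k * (\<phi> k x)\<^sup>2)))"
    using int integrable_diag integrable_square[OF g] square_le_diag_defect[OF I g orth]
    by (intro integral_mono) (auto simp: space_M)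
  also have "\<dots> = ip g g * ((LINT x|M. K x x) - (LINT x|M. (\<Sum>k\<in>I. lam k * (\<phi> k x)\<^sup>2)))"
    using int integrable_diag by simp
  also have "(LINT x|M. (\<Sum>k\<in>I. lam k * (\<phi> k x)\<^sup>2)) = (\<Sum>k\<in>I. lam k * (LINT x|M. \<phi> k x * \<phi> k x))"
    using I by (subst Bochner_Integration.integral_sum)
      (auto simp: \<phi>_integrable_square subset_iff simp flip: power2_eq_square)
  also have "\<dots> = sum lam I" using I by (intro sum.cong) (auto simp: orthonormal subset_iff)
  finally show ?thesis .
qed

text \<open>
  Only finitely many eigenfunctions are ever summed: \<open>I\<close> is enlarged to a finite \<open>J\<close> whose
  eigenvalues carry all of the trace but \<open>e\<close>. The squared error of \<open>proj I\<close> is that of \<open>proj J\<close>, at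
  most \<open>e * ip f f\<close>, plus the squared coefficients with index in \<open>J - I\<close>, whose sum is at most
  \<open>\<Lambda> * ip f f\<close> by Bessel's inequality in \<open>H\<close>.
\<close>

theorem projection_error:
  assumes I: "finite I" "I \<subseteq> L" and f: "f \<in> H"
    and tail: "\<And>k. k \<in> L - I \<Longrightarrow> lam k \<le> \<Lambda>" and "0 \<le> \<Lambda>"
  shows "(LINT x|M. (f x - proj I f x)\<^sup>2) \<le> \<Lambda> * ip f f"
proof -
  have "(LINT x|M. (f x - proj I f x)\<^sup>2) \<le> \<Lambda> * ip f f + e * ip f f" if e: "0 < e" for e
  proof -
    obtain J0 where J0: "J0 \<subseteq> L" "finite J0" and tr: "(LINT x|M. K x x) - e < sum lam J0"
      using trace[OF e] by blast
    define J where "J = I \<union> J0"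
    have J: "finite J" "J \<subseteq> L" using I J0 by (auto simp: J_def)
    have "sum lam J0 \<le> sum lam J"
      using J lam_pos by (intro sum_mono2) (auto simp: J_def less_imp_le subset_iff)
    then have defect: "(LINT x|M. K x x) - sum lam J \<le> e" using tr by linarith
    let ?g = "\<lambda>x. f x - proj J f x"
    have g: "?g \<in> H" using residual_mem[OF J f] .
    have "coef ?g k = 0" if k: "k \<in> J" for k
    proof -
      have kL: "k \<in> L" using k J by blast
      have "coef ?g k = lam k * (ip f (\<phi> k) - ip (proj J f) (\<phi> k))"
        using kL g f proj_mem[OF J] by (simp add: coef_eq ip_diff_left \<phi>_mem)
      also have "\<dots> = coef f k - coef (proj J f) k"
        using kL f proj_mem[OF J] by (simp add: coef_eq right_diff_distrib)
      also have "coef (proj J f) k = coef f k"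
        unfolding proj_def using coef_comb[OF J kL] k by simp
      finally show ?thesis by simp
    qed
    then have "(LINT x|M. (?g x)\<^sup>2) \<le> ip ?g ?g * ((LINT x|M. K x x) - sum lam J)"
      by (intro integral_square_le_trace_defect J g)
    also have "\<dots> \<le> ip ?g ?g * e" using defect ip_nonneg[OF g] by (intro mult_left_mono)
    also have "\<dots> \<le> ip f f * e"
    proof (intro mult_right_mono)
      have "0 \<le> (\<Sum>k\<in>J. (coef f k)\<^sup>2 / lam k)"
        using J lam_pos by (intro sum_nonneg divide_nonneg_pos) auto
      then show "ip ?g ?g \<le> ip f f" using ip_residual_self[OF J f] by simp
    qed (use e in simp)
    finally have far: "(LINT x|M. (f x - proj J f x)\<^sup>2) \<le> e * ip f f" by (simp add: mult.commute)
    have split: "(\<Sum>k\<in>J. (coef f k)\<^sup>2) = (\<Sum>k\<in>I. (coef f k)\<^sup>2) + (\<Sum>k\<in>J - I. (coef f k)\<^sup>2)"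
      using J by (metis J_def Un_upper1 add.commute sum.subset_diff)
    have "(\<Sum>k\<in>J - I. (coef f k)\<^sup>2) \<le> (\<Sum>k\<in>J - I. \<Lambda> * ((coef f k)\<^sup>2 / lam k))"
    proof (rule sum_mono)
      fix k assume k: "k \<in> J - I"
      then have "0 < lam k" "lam k \<le> \<Lambda>" using lam_pos tail J by auto
      then have "(coef f k)\<^sup>2 * lam k \<le> (coef f k)\<^sup>2 * \<Lambda>" by (intro mult_left_mono) auto
      then show "(coef f k)\<^sup>2 \<le> \<Lambda> * ((coef f k)\<^sup>2 / lam k)"
        using \<open>0 < lam k\<close> by (simp add: field_simps)
    qed
    also have "\<dots> = \<Lambda> * (\<Sum>k\<in>J - I. (coef f k)\<^sup>2 / lam k)" by (simp add: sum_distrib_left)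
    also have "\<dots> \<le> \<Lambda> * ip f f"
      using J f \<open>0 \<le> \<Lambda>\<close> by (intro mult_left_mono bessel) auto
    finally show ?thesis
      using integral_residual_square[OF I f] integral_residual_square[OF J f] far split by linarith
  qed
  note bound = this
  show ?thesis
  proof (rule field_le_epsilon)
    fix e :: real assume e: "0 < e"
    have n: "0 \<le> ip f f" using f by (rule ip_nonneg)
    have "(LINT x|M. (f x - proj I f x)\<^sup>2) \<le> \<Lambda> * ip f f + e / (ip f f + 1) * ip f f"
      using e n by (intro bound) simp
    also have "e / (ip f f + 1) * ip f f \<le> e" using e n by (simp add: field_simps)
    finally show "(LINT x|M. (f x - proj I f x)\<^sup>2) \<le> \<Lambda> * ip f f + e" by simp
  qed
qed

text \<open>
  The \<open>card I\<close> coefficients of a combination of eigenfunctions can be chosen to satisfy \<open>n < card I\<close>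
  linear conditions. An algorithm that uses only these functionals maps the combination to zero.
\<close>

theorem exists_in_kernel_of_functionals:
  assumes I: "finite I" "I \<subseteq> L" "n < card I" and l: "\<And>i. i \<in> {1..n} \<Longrightarrow> l i \<in> hdual H ip"
    and large: "\<And>k. k \<in> I \<Longrightarrow> \<Lambda> \<le> lam k"
  shows "\<exists>f\<in>hball H ip. (\<forall>i\<in>{1..n}. l i f = 0) \<and> \<Lambda> \<le> (LINT x|M. (f x)\<^sup>2)"
proof -
  have l_comb: "l i (\<lambda>x. \<Sum>k\<in>A. c k * \<phi> k x) = (\<Sum>k\<in>A. c k * l i (\<phi> k))"
    if "i \<in> {1..n}" "finite A" "A \<subseteq> L" for i A c
    using that(2,3)
  proof (induction A rule: finite_induct)
    case empty
    have "\<forall>c. \<forall>f\<in>H. l i (\<lambda>x. c * f x) = c * l i f" using l[OF that(1)] unfolding hdual_def by blast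
    from bspec[OF spec[OF this, of 0] zero_closed]
    show ?case by simp
  next
    case (insert a A)
    have "l i (\<lambda>x. c a * \<phi> a x + (\<Sum>k\<in>A. c k * \<phi> k x))
        = l i (\<lambda>x. c a * \<phi> a x) + l i (\<lambda>x. \<Sum>k\<in>A. c k * \<phi> k x)"
      using l[OF that(1)] insert scale_closed \<phi>_mem comb_mem unfolding hdual_def by auto
    moreover have "l i (\<lambda>x. c a * \<phi> a x) = c a * l i (\<phi> a)"
      using l[OF that(1)] insert \<phi>_mem unfolding hdual_def by auto
    ultimately show ?case using insert by simp
  qed
  obtain c where c: "\<exists>k\<in>I. c k \<noteq> 0" and sol: "\<And>i. i \<in> {1..n} \<Longrightarrow> (\<Sum>k\<in>I. c k * l i (\<phi> k)) = 0"
    using homogeneous_system_nontrivial[OF I(1,3), of "\<lambda>i k. l i (\<phi> k)"] by blast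
  define q where "q = (\<Sum>k\<in>I. (c k)\<^sup>2 / lam k)"
  have q: "0 < q"
  proof -
    obtain k where "k \<in> I" "c k \<noteq> 0" using c by blast
    then show ?thesis unfolding q_def
      using I lam_pos by (intro sum_pos2[of I k]) (auto intro!: divide_pos_pos divide_nonneg_pos)
  qed
  define f where "f = (\<lambda>x. \<Sum>k\<in>I. (c k / sqrt q) * \<phi> k x)"
  have f: "f \<in> H" unfolding f_def using I by (intro comb_mem)
  have "ip f f = (\<Sum>k\<in>I. (c k / sqrt q)\<^sup>2 / lam k)"
    unfolding f_def by (rule ip_comb_self[OF I(1,2)])
  also have "\<dots> = (\<Sum>k\<in>I. (c k)\<^sup>2 / lam k / q)"
    using q by (intro sum.cong) (simp_all add: power_divide)
  also have "\<dots> = q / q" by (simp only: q_def sum_divide_distrib[symmetric])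
  finally have "ip f f = q / q" .
  then have "f \<in> hball H ip" using f q by (simp add: hball_def hnorm_def)
  moreover have "l i f = 0" if i: "i \<in> {1..n}" for i
  proof -
    have "l i f = (\<Sum>k\<in>I. c k * l i (\<phi> k)) / sqrt q"
      unfolding f_def by (subst l_comb[OF i I(1,2)]) (simp add: sum_divide_distrib)
    then show ?thesis using sol[OF i] by simp
  qed
  moreover have "\<Lambda> \<le> (LINT x|M. (f x)\<^sup>2)"
  proof -
    have "\<Lambda> * q \<le> (\<Sum>k\<in>I. (c k)\<^sup>2)"
      unfolding q_def sum_distrib_left
    proof (rule sum_mono)
      fix k assume k: "k \<in> I"
      then have "0 < lam k" using I lam_pos by blast
      moreover have "\<Lambda> * (c k)\<^sup>2 \<le> lam k * (c k)\<^sup>2" using large[OF k] by (intro mult_right_mono) auto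
      ultimately show "\<Lambda> * ((c k)\<^sup>2 / lam k) \<le> (c k)\<^sup>2" by (simp add: field_simps)
    qed
    also have "(\<Sum>k\<in>I. (c k)\<^sup>2) = q * (LINT x|M. (f x)\<^sup>2)"
      unfolding f_def using q by (subst integral_comb_square[OF I(1,2)])
        (simp add: power_divide flip: sum_divide_distrib)
    finally show ?thesis using q by simp
  qed
  ultimately show ?thesis by blast
qed

end

section \<open>Gaussian means of polynomials and Hermite polynomials\<close>

definition gauss_density :: "real \<Rightarrow> real" where
  "gauss_density y = exp (- y\<^sup>2) / sqrt pi"

text \<open>
  The expectation of \<open>p(b + c * Y)\<close> where \<open>Y\<close> has density \<open>gauss_density\<close>, hence variance \<open>1 / 2\<close>.
\<close>

definition gauss_mean :: "real \<Rightarrow> real \<Rightarrow> real poly \<Rightarrow> real" where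
  "gauss_mean b c p = (LBINT y. poly p (b + c * y) * gauss_density y)"

lemma gaussian_moment_even:
  "has_bochner_integral lborel (\<lambda>y. y ^ (2 * k) * gauss_density y) (fact (2 * k) / (4 ^ k * fact k))"
proof -
  have "has_bochner_integral lborel (\<lambda>x. exp (-x\<^sup>2) * x ^ (2 * k))
      (sqrt pi * (fact (2 * k) / (2 ^ (2 * k) * fact k)))"
    using has_bochner_integral_even_function[OF gaussian_moment_even_pos[where k=k]] by simp
  then have "has_bochner_integral lborel (\<lambda>x. (1 / sqrt pi) * (exp (-x\<^sup>2) * x ^ (2 * k)))
      ((1 / sqrt pi) * (sqrt pi * (fact (2 * k) / (2 ^ (2 * k) * fact k))))"
    by (rule has_bochner_integral_mult_right)
  moreover have "(2::real) ^ (2 * k) = 4 ^ k" by (simp add: power_mult)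
  ultimately show ?thesis by (simp add: gauss_density_def mult.commute)
qed

lemma gaussian_moment_odd:
  "has_bochner_integral lborel (\<lambda>y. y ^ (2 * k + 1) * gauss_density y) 0"
proof -
  have "has_bochner_integral lborel (\<lambda>x. exp (-x\<^sup>2) * x ^ (2 * k + 1) :: real) 0"
    using gaussian_moment_odd_pos by (rule has_bochner_integral_odd_function) simp
  then have "has_bochner_integral lborel (\<lambda>x. (1 / sqrt pi) * (exp (-x\<^sup>2) * x ^ (2 * k + 1))) ((1 / sqrt pi) * 0)"
    by (rule has_bochner_integral_mult_right)
  then show ?thesis by (simp add: gauss_density_def mult_ac)
qed

lemma integrable_gaussian_moment: "integrable lborel (\<lambda>y. y ^ n * gauss_density y)"
proof (cases "even n")
  case True
  then show ?thesis using gaussian_moment_even by (auto elim!: evenE simp: has_bochner_integral_iff)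
next
  case False
  then show ?thesis using gaussian_moment_odd by (auto elim!: oddE simp: has_bochner_integral_iff)
qed

lemma gaussian_moment_recurrence:
  "(LBINT y. y ^ Suc n * gauss_density y) = real n / 2 * (LBINT y. y ^ (n - 1) * gauss_density y)"
proof (cases "even n")
  case True
  then obtain k where n: "n = 2 * k" by (elim evenE)
  have odd: "(LBINT y. y ^ (2 * j + 1) * gauss_density y) = 0" for j
    using gaussian_moment_odd[of j] by (simp add: has_bochner_integral_iff)
  show ?thesis
  proof (cases k)
    case 0
    then show ?thesis using odd[of 0] n by simp
  next
    case (Suc j)
    then have eqs: "n - 1 = 2 * j + 1" "Suc n = 2 * k + 1" using n by simp_all
    show ?thesis unfolding eqs odd by simp
  qed
next
  case False
  then obtain k where n: "n = 2 * k + 1" by (elim oddE)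
  have even: "(LBINT y. y ^ (2 * j) * gauss_density y) = fact (2 * j) / (4 ^ j * fact j)" for j
    using gaussian_moment_even[of j] by (simp add: has_bochner_integral_iff)
  have "Suc n = 2 * Suc k" "n - 1 = 2 * k" using n by simp_all
  then have "(LBINT y. y ^ Suc n * gauss_density y) = fact (2 * Suc k) / (4 ^ Suc k * fact (Suc k))"
    "(LBINT y. y ^ (n - 1) * gauss_density y) = fact (2 * k) / (4 ^ k * fact k)"
    by (simp_all only: even)
  moreover have "fact (2 * Suc k) / (4 ^ Suc k * fact (Suc k))
      = real n / 2 * (fact (2 * k) / (4 ^ k * fact k))"
    by (simp add: n divide_simps)
  ultimately show ?thesis by (simp only:)
qed

lemma integrable_poly_gauss_density: "integrable lborel (\<lambda>y. poly p y * gauss_density y)"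
proof -
  have "integrable lborel (\<lambda>y. \<Sum>i\<le>degree p. coeff p i * (y ^ i * gauss_density y))"
    by (intro Bochner_Integration.integrable_sum integrable_mult_right integrable_gaussian_moment)
  then show ?thesis by (simp add: poly_altdef sum_distrib_right mult.assoc)
qed

lemma integrable_gauss_mean: "integrable lborel (\<lambda>y. poly p (b + c * y) * gauss_density y)"
  using integrable_poly_gauss_density[of "pcompose p [:b, c:]"] by (simp add: poly_pcompose mult.commute)

lemma gauss_mean_add: "gauss_mean b c (p + q) = gauss_mean b c p + gauss_mean b c q"
  unfolding gauss_mean_def by (simp add: distrib_right integrable_gauss_mean)

lemma gauss_mean_diff: "gauss_mean b c (p - q) = gauss_mean b c p - gauss_mean b c q"
  unfolding gauss_mean_def by (simp add: left_diff_distrib integrable_gauss_mean)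

lemma gauss_mean_smult: "gauss_mean b c (smult k p) = k * gauss_mean b c p"
  unfolding gauss_mean_def by (simp add: mult.assoc)

lemma gauss_mean_0: "gauss_mean b c 0 = 0"
  by (simp add: gauss_mean_def)

lemma gauss_mean_1: "gauss_mean b c 1 = 1"
  using gaussian_moment_even[of 0] by (simp add: gauss_mean_def has_bochner_integral_iff)

lemma gauss_mean_standard: "gauss_mean b c p = gauss_mean 0 1 (pcompose p [:b, c:])"
  by (simp add: gauss_mean_def poly_pcompose mult.commute)

text \<open>
  Gaussian integration by parts, reduced to the recurrence of the moments. The factor \<open>monom 1 n\<close> in
  the induction makes the statement stable under splitting off the constant coefficient of \<open>p\<close>.
\<close>

lemma gauss_mean_by_parts_standard:
  "gauss_mean 0 1 ([:0, 1:] * p) = gauss_mean 0 1 (pderiv p) / 2"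
proof -
  have monom: "gauss_mean 0 1 (monom a n) = a * (LBINT y. y ^ n * gauss_density y)" for a n
    by (simp add: gauss_mean_def poly_monom mult.assoc)
  have "gauss_mean 0 1 ([:0, 1:] * (monom 1 n * p)) = gauss_mean 0 1 (pderiv (monom 1 n * p)) / 2"
    for n
  proof (induction p arbitrary: n)
    case (pCons a q)
    have eq: "monom 1 n * pCons a q = monom a n + monom 1 (Suc n) * q"
      by (simp add: monom_Suc mult_pCons_right smult_monom)
    have "[:0, 1:] * monom a n = monom a (Suc n)" by (simp add: monom_Suc)
    then have "gauss_mean 0 1 ([:0, 1:] * monom a n) = gauss_mean 0 1 (pderiv (monom a n)) / 2"
      by (simp only: monom pderiv_monom gaussian_moment_recurrence) simp
    then show ?case
      using pCons.IH[of "Suc n"] unfolding eq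
      by (simp only: distrib_left pderiv_add gauss_mean_add add_divide_distrib)
  qed (simp add: gauss_mean_0)
  from this[of 0] show ?thesis by (simp add: monom_0 flip: one_pCons)
qed

lemma gauss_mean_by_parts:
  "gauss_mean b c ([:- b, 1:] * p) = c\<^sup>2 / 2 * gauss_mean b c (pderiv p)"
proof -
  have "pcompose [:- b, 1:] [:b, c:] = smult c [:0, 1:]" by (simp add: pcompose_pCons)
  then have "gauss_mean b c ([:- b, 1:] * p) = c * gauss_mean 0 1 ([:0, 1:] * pcompose p [:b, c:])"
    by (subst gauss_mean_standard) (simp only: pcompose_mult mult_smult_left gauss_mean_smult)
  also have "\<dots> = c * (gauss_mean 0 1 (pderiv (pcompose p [:b, c:])) / 2)"
    by (simp only: gauss_mean_by_parts_standard)
  also have "pderiv (pcompose p [:b, c:]) = smult c (pcompose (pderiv p) [:b, c:])"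
    by (simp add: pderiv_pcompose pderiv_pCons)
  finally show ?thesis
    by (subst (2) gauss_mean_standard) (simp add: gauss_mean_smult power2_eq_square)
qed

text \<open>
  The polynomials \<open>r ^ (k / 2) * H\<^sub>k(x * sqrt r)\<close> for the physicists' Hermite polynomials \<open>H\<^sub>k\<close>: they are
  orthogonal for the weight \<open>exp (- r * x\<^sup>2)\<close>.
\<close>

fun hermite :: "real \<Rightarrow> nat \<Rightarrow> real poly" where
  "hermite r 0 = 1"
| "hermite r (Suc k) = smult (2 * r) ([:0, 1:] * hermite r k) - pderiv (hermite r k)"

lemma pderiv_hermite: "pderiv (hermite r (Suc k)) = smult (2 * r * real (Suc k)) (hermite r k)"
proof (induction k)
  case 0
  show ?case by (simp add: pderiv_pCons pderiv_1 flip: one_pCons)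
next
  case (Suc k)
  let ?h = "hermite r"
  have "pderiv (smult (2 * r) ([:0, 1:] * g) - pderiv g)
      = smult (2 * r) (g + [:0, 1:] * pderiv g) - pderiv (pderiv g)" for g :: "real poly"
    by (simp only: pderiv_diff pderiv_smult pderiv_mult) (simp add: pderiv_pCons add.commute)
  then have "pderiv (?h (Suc (Suc k)))
      = smult (2 * r) (?h (Suc k) + [:0, 1:] * pderiv (?h (Suc k))) - pderiv (pderiv (?h (Suc k)))"
    by (simp only: hermite.simps(2)[of r "Suc k"])
  also have "\<dots> = smult (2 * r) (?h (Suc k))
      + smult (2 * r * real (Suc k)) (smult (2 * r) ([:0, 1:] * ?h k) - pderiv (?h k))"
    unfolding Suc.IH by (simp add: pderiv_smult smult_add_right smult_diff_right mult.commute)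
  also have "\<dots> = smult (2 * r * real (Suc (Suc k))) (?h (Suc k))"
    by (simp only: hermite.simps(2)[symmetric] smult_add_left[symmetric]) (simp add: algebra_simps)
  finally show ?case .
qed

text \<open>
  The Mehler semigroup has the Hermite polynomials as eigenfunctions. The operator
  \<open>p \<mapsto> 2 r x p - p'\<close> that raises the degree is moved through the expectation with integration by
  parts; \<open>r * c\<^sup>2 = 1 - w\<^sup>2\<close> is exactly what makes the terms with \<open>p'\<close> combine to \<open>w\<close> times the raised
  eigenfunction.
\<close>

lemma gauss_mean_hermite:
  assumes rc: "r * c\<^sup>2 = 1 - w\<^sup>2"
  shows "gauss_mean (w * t) c (hermite r k) = w ^ k * poly (hermite r k) t"
proof (induction k rule: less_induct)
  case (less k)
  show ?case
  proof (cases k)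
    case 0
    then show ?thesis by (simp add: gauss_mean_1)
  next
    case (Suc n)
    let ?h = "hermite r" and ?G = "gauss_mean (w * t) c"
    \<comment> \<open>The derivative of a Hermite polynomial is a multiple of the previous one, so the induction hypothesis covers it; the factor \<open>w\<close> avoids the exponent \<open>n - 1\<close>.\<close>
    have deriv: "?G (pderiv (?h n)) * w = w ^ n * poly (pderiv (?h n)) t"
    proof (cases n)
      case 0
      then show ?thesis by (simp add: gauss_mean_0 pderiv_1)
    next
      case (Suc m)
      then show ?thesis using less[of m] \<open>k = Suc n\<close>
        by (simp add: pderiv_hermite gauss_mean_smult del: hermite.simps)
    qed
    have "[:0, 1:] * ?h n = smult (w * t) (?h n) + [:- (w * t), 1:] * ?h n" by simp
    then have "?G ([:0, 1:] * ?h n) = w * t * ?G (?h n) + c\<^sup>2 / 2 * ?G (pderiv (?h n))"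
      by (metis gauss_mean_add gauss_mean_smult gauss_mean_by_parts)
    then have "?G (?h k) = 2 * r * w * t * ?G (?h n) + (r * c\<^sup>2 - 1) * ?G (pderiv (?h n))"
      using Suc by (simp only: hermite.simps gauss_mean_diff gauss_mean_smult) (simp add: algebra_simps)
    also have "\<dots> = 2 * r * w * t * (w ^ n * poly (?h n) t) - w * (?G (pderiv (?h n)) * w)"
      using less[of n] Suc rc by (simp add: power2_eq_square)
    also have "\<dots> = w ^ k * poly (?h k) t"
      unfolding deriv using Suc by (simp add: algebra_simps)
    finally show ?thesis .
  qed
qed

text \<open>
  Raising the degree and differentiation are adjoint for the weight \<open>exp (- r * x\<^sup>2)\<close>.
\<close>

lemma gauss_mean_hermite_mult:
  assumes rc: "r * c\<^sup>2 = 1"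
  shows "gauss_mean 0 c (hermite r (Suc k) * q) = gauss_mean 0 c (hermite r k * pderiv q)"
proof -
  have "smult (2 * r) ([:- 0, 1:] * (hermite r k * q)) - pderiv (hermite r k * q) + hermite r k * pderiv q
      = hermite r (Suc k) * q"
    by (simp add: pderiv_mult algebra_simps)
  then have "gauss_mean 0 c (hermite r (Suc k) * q) =
      2 * r * gauss_mean 0 c ([:- 0, 1:] * (hermite r k * q)) - gauss_mean 0 c (pderiv (hermite r k * q))
      + gauss_mean 0 c (hermite r k * pderiv q)"
    by (metis gauss_mean_add gauss_mean_diff gauss_mean_smult)
  also have "2 * r * gauss_mean 0 c ([:- 0, 1:] * (hermite r k * q)) = (r * c\<^sup>2) * gauss_mean 0 c (pderiv (hermite r k * q))"
    unfolding gauss_mean_by_parts by simp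
  finally show ?thesis using rc by simp
qed

lemma hermite_orthogonal:
  assumes rc: "r * c\<^sup>2 = 1"
  shows "gauss_mean 0 c (hermite r k * hermite r j) = (if k = j then (2 * r) ^ k * fact k else 0)"
proof (induction k arbitrary: j)
  case 0
  show ?case
  proof (cases j)
    case (Suc i)
    then show ?thesis
      using gauss_mean_hermite_mult[OF rc, of i 1] by (simp add: gauss_mean_0 pderiv_1 del: hermite.simps(2))
  qed (simp add: gauss_mean_1)
next
  case (Suc k)
  show ?case
  proof (cases j)
    case 0
    then show ?thesis
      using gauss_mean_hermite_mult[OF rc, of k 1] by (simp add: gauss_mean_0 pderiv_1 del: hermite.simps(2))
  next
    case (Suc i)
    then show ?thesis
      unfolding Suc gauss_mean_hermite_mult[OF rc] pderiv_hermite
      using Suc.IH[of i] by (simp add: gauss_mean_smult del: hermite.simps)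
  qed
qed

definition eigenfun :: "real \<Rightarrow> nat \<Rightarrow> real \<Rightarrow> real" where
  "eigenfun a k x = sqrt (sqrt (1 + 2 * a) / ((2 * (1 + 2 * a)) ^ k * fact k))
     * (poly (hermite (1 + 2 * a) k) x * exp (- a * x\<^sup>2))"

lemma eigenfun_measurable [measurable]: "eigenfun a k \<in> borel_measurable borel"
  unfolding eigenfun_def by (intro borel_measurable_continuous_onI continuous_intros)

text \<open>
  The factors \<open>exp (- a * x\<^sup>2)\<close> and the density combine to the weight \<open>exp (- (1 + 2 * a) * x\<^sup>2)\<close>,
  which the substitution \<open>x = y / sqrt (1 + 2 * a)\<close> reduces to \<open>hermite_orthogonal\<close>.
\<close>

lemma eigenfun_orthonormal:
  assumes "0 \<le> a"
  shows "has_bochner_integral lborel (\<lambda>x. eigenfun a k x * eigenfun a j x * gauss_density x)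
    (if k = j then 1 else 0)"
proof -
  define r where "r = 1 + 2 * a"
  have r: "0 < r" using assms by (simp add: r_def)
  define c where "c = 1 / sqrt r"
  have c: "0 < c" "r * c\<^sup>2 = 1" using r by (simp_all add: c_def power_divide)
  define C where "C n = sqrt (sqrt r / ((2 * r) ^ n * fact n))" for n
  let ?f = "\<lambda>x. eigenfun a k x * eigenfun a j x * gauss_density x"
  let ?g = "\<lambda>y. poly (hermite r k * hermite r j) (0 + c * y) * gauss_density y"
  have f_eq: "?f (0 + c * y) = (C k * C j) * ?g y" for y
  proof -
    have "- a * (c * y)\<^sup>2 + - a * (c * y)\<^sup>2 + - (c * y)\<^sup>2 = - (r * c\<^sup>2) * y\<^sup>2"
      by (simp add: r_def power_mult_distrib algebra_simps)
    then have "exp (- a * (c * y)\<^sup>2) * exp (- a * (c * y)\<^sup>2) * exp (- (c * y)\<^sup>2) = exp (- y\<^sup>2)"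
      unfolding c(2) by (simp only: exp_add[symmetric]) simp
    then show ?thesis
      by (simp add: eigenfun_def C_def gauss_density_def flip: r_def)
  qed
  have "integrable lborel ?f"
    using c(1) by (subst lborel_integrable_real_affine_iff[where c = c and t = 0, symmetric])
      (simp_all only: f_eq integrable_mult_right integrable_gauss_mean)
  moreover have "(LBINT x. ?f x) = (if k = j then 1 else 0)"
  proof -
    have "(LBINT x. ?f x) = c * (LBINT y. ?f (0 + c * y))"
      using c(1) by (subst lborel_integral_real_affine[where c = c and t = 0]) auto
    also have "\<dots> = c * (C k * C j) * gauss_mean 0 c (hermite r k * hermite r j)"
      unfolding f_eq gauss_mean_def by simp
    also have "\<dots> = (if k = j then c * ((C k)\<^sup>2 * ((2 * r) ^ k * fact k)) else 0)"
      unfolding hermite_orthogonal[OF c(2)] by (simp add: power2_eq_square)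
    also have "c * ((C k)\<^sup>2 * ((2 * r) ^ k * fact k)) = 1"
      using r by (simp add: C_def c_def)
    finally show ?thesis by simp
  qed
  ultimately show ?thesis by (simp add: has_bochner_integral_iff)
qed

text \<open>
  In the variable \<open>y = (1 + a) * s - a * t\<close> the product of the kernel, of \<open>exp (- a * s\<^sup>2)\<close> and of the
  density is \<open>exp (- a * t\<^sup>2) * exp (- y\<^sup>2)\<close>, and \<open>s = w * t + u * y\<close> with \<open>w = a / (1 + a)\<close> and
  \<open>u = 1 / (1 + a)\<close>. What is left is the Mehler semigroup.
\<close>

lemma eigenfun_equation:
  assumes "0 \<le> a"
  shows "has_bochner_integral lborel
    (\<lambda>s. exp (- (a + a\<^sup>2) * (t - s)\<^sup>2) * eigenfun a k s * gauss_density s)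
    (1 / (1 + a) * (a / (1 + a)) ^ k * eigenfun a k t)"
proof -
  define r where "r = 1 + 2 * a"
  define u where "u = 1 / (1 + a)"
  define w where "w = a / (1 + a)"
  have u: "0 < u" and a1: "1 + a \<noteq> 0" using assms by (simp_all add: u_def)
  have u1: "(1 + a) * u = 1" and w_eq: "w = a * u" using a1 by (simp_all add: u_def w_def)
  have ru: "r * u\<^sup>2 = 1 - w\<^sup>2"
    using a1 by (simp add: r_def u_def w_def power_divide divide_simps)
      (simp add: power2_eq_square algebra_simps)
  define C where "C = sqrt (sqrt r / ((2 * r) ^ k * fact k))"
  let ?f = "\<lambda>s. exp (- (a + a\<^sup>2) * (t - s)\<^sup>2) * eigenfun a k s * gauss_density s"
  let ?g = "\<lambda>y. poly (hermite r k) (w * t + u * y) * gauss_density y"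
  have f_eq: "?f (w * t + u * y) = (C * exp (- a * t\<^sup>2)) * ?g y" for y
  proof -
    let ?s = "w * t + u * y"
    have "(1 + a) * ?s = ((1 + a) * u) * (a * t + y)" by (simp add: w_eq algebra_simps)
    then have y: "(1 + a) * ?s - a * t = y" by (simp add: u1)
    have "- (a + a\<^sup>2) * (t - s)\<^sup>2 + - a * s\<^sup>2 + - s\<^sup>2 = - a * t\<^sup>2 + - ((1 + a) * s - a * t)\<^sup>2" for s
      by (simp add: power2_eq_square algebra_simps)
    from this[of ?s] have "- (a + a\<^sup>2) * (t - ?s)\<^sup>2 + - a * ?s\<^sup>2 + - ?s\<^sup>2 = - a * t\<^sup>2 + - y\<^sup>2"
      by (simp only: y)
    then have e: "exp (- (a + a\<^sup>2) * (t - ?s)\<^sup>2) * exp (- a * ?s\<^sup>2) * exp (- ?s\<^sup>2) = exp (- a * t\<^sup>2) * exp (- y\<^sup>2)"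
      by (simp only: exp_add[symmetric])
    have "?f s = exp (- (a + a\<^sup>2) * (t - s)\<^sup>2) * exp (- a * s\<^sup>2) * exp (- s\<^sup>2)
        * (C * poly (hermite r k) s / sqrt pi)" for s
      unfolding eigenfun_def C_def gauss_density_def r_def by (simp only: mult_ac times_divide_eq_right times_divide_eq_left)
    from this[of ?s] have "?f ?s = exp (- a * t\<^sup>2) * exp (- y\<^sup>2) * (C * poly (hermite r k) ?s / sqrt pi)"
      by (simp only: e)
    also have "\<dots> = (C * exp (- a * t\<^sup>2)) * ?g y" by (simp add: gauss_density_def)
    finally show ?thesis .
  qed
  have "integrable lborel ?f"
    using u by (subst lborel_integrable_real_affine_iff[where c = u and t = "w * t", symmetric])
      (simp_all only: f_eq integrable_mult_right integrable_gauss_mean)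
  moreover have "(LBINT s. ?f s) = u * w ^ k * eigenfun a k t"
  proof -
    have "(LBINT s. ?f s) = u * (LBINT y. ?f (w * t + u * y))"
      using u by (subst lborel_integral_real_affine[where c = u and t = "w * t"]) auto
    also have "\<dots> = u * (C * exp (- a * t\<^sup>2)) * gauss_mean (w * t) u (hermite r k)"
      unfolding f_eq gauss_mean_def by simp
    also have "\<dots> = u * w ^ k * eigenfun a k t"
      unfolding gauss_mean_hermite[OF ru] by (simp add: eigenfun_def C_def flip: r_def)
    finally show ?thesis .
  qed
  ultimately show ?thesis by (simp add: has_bochner_integral_iff u_def w_def)
qed

section \<open>Tensor products\<close>

lemma space_gauss_measure: "space (gauss_measure d) = Rd d"
  by (simp add: gauss_measure_def Rd_def space_PiM)

lemma sets_gauss_measure: "sets (gauss_measure d) = sets (\<Pi>\<^sub>M j\<in>{..<d}. lborel)"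
  by (simp add: gauss_measure_def)

lemma has_bochner_integral_gauss_measure_prod:
  assumes f [measurable]: "\<And>j. f j \<in> borel_measurable borel"
    and m: "\<And>j. j < d \<Longrightarrow> has_bochner_integral lborel (\<lambda>y. f j y * gauss_density y) (m j)"
  shows "has_bochner_integral (gauss_measure d) (\<lambda>x. \<Prod>j<d. f j (x j)) (\<Prod>j<d. m j)"
proof -
  interpret product_sigma_finite "\<lambda>_::nat. lborel :: real measure" by standard
  let ?P = "\<Pi>\<^sub>M j\<in>{..<d}. lborel :: real measure"
  let ?w = "\<lambda>x::nat \<Rightarrow> real. \<Prod>j<d. exp (- (x j)\<^sup>2) / sqrt pi"
  have w: "?w \<in> borel_measurable ?P" by measurable
  have F: "(\<lambda>x. \<Prod>j<d. f j (x j)) \<in> borel_measurable ?P" by measurable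
  have nn: "AE x in ?P. 0 \<le> ?w x" by (intro AE_I2 prod_nonneg) simp
  have eq: "?w x *\<^sub>R (\<Prod>j<d. f j (x j)) = (\<Prod>j<d. f j (x j) * gauss_density (x j))" for x
    by (simp add: gauss_density_def mult.commute flip: prod.distrib)
  have int: "integrable lborel (\<lambda>y. f j y * gauss_density y)"
    "(LBINT y. f j y * gauss_density y) = m j" if "j < d" for j
    using m[OF that] by (simp_all add: has_bochner_integral_iff)
  have "integrable (gauss_measure d) (\<lambda>x. \<Prod>j<d. f j (x j))"
    unfolding gauss_measure_def integrable_density[OF F w nn] eq
    using int(1) by (intro product_integrable_prod) auto
  moreover have "(LINT x|gauss_measure d. (\<Prod>j<d. f j (x j))) = (\<Prod>j<d. m j)"
    unfolding gauss_measure_def integral_density[OF F w nn] eq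
    using int by (subst product_integral_prod) auto
  ultimately show ?thesis by (simp add: has_bochner_integral_iff)
qed

lemma has_bochner_integral_gauss_measure_cong:
  fixes f g :: "(nat \<Rightarrow> real) \<Rightarrow> real"
  assumes "has_bochner_integral (gauss_measure d) f m" "\<And>x. x \<in> Rd d \<Longrightarrow> g x = f x" "m' = m"
  shows "has_bochner_integral (gauss_measure d) g m'"
  using assms by (metis has_bochner_integral_cong space_gauss_measure)

definition multi_indices :: "nat \<Rightarrow> (nat \<Rightarrow> nat) set" where
  "multi_indices d = {..<d} \<rightarrow>\<^sub>E UNIV"

definition tensor_eigenfun :: "real \<Rightarrow> nat \<Rightarrow> (nat \<Rightarrow> nat) \<Rightarrow> (nat \<Rightarrow> real) \<Rightarrow> real" where
  "tensor_eigenfun a d k x = (if x \<in> Rd d then \<Prod>j<d. eigenfun a (k j) (x j) else 0)"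

definition tensor_eigenvalue :: "real \<Rightarrow> nat \<Rightarrow> (nat \<Rightarrow> nat) \<Rightarrow> real" where
  "tensor_eigenvalue a d k = (1 / (1 + a)) ^ d * (a / (1 + a)) ^ (\<Sum>j<d. k j)"

lemma tensor_eigenvalue_prod:
  "tensor_eigenvalue a d k = (\<Prod>j<d. 1 / (1 + a) * (a / (1 + a)) ^ k j)"
  by (simp only: tensor_eigenvalue_def prod.distrib prod_constant power_sum) simp

lemma tensor_eigenfun_orthonormal:
  assumes "0 \<le> a" "k \<in> multi_indices d" "l \<in> multi_indices d"
  shows "has_bochner_integral (gauss_measure d)
    (\<lambda>x. tensor_eigenfun a d k x * tensor_eigenfun a d l x) (if k = l then 1 else 0)"
proof -
  have "has_bochner_integral (gauss_measure d)
      (\<lambda>x. \<Prod>j<d. eigenfun a (k j) (x j) * eigenfun a (l j) (x j)) (\<Prod>j<d. if k j = l j then 1 else 0)"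
    using assms(1) eigenfun_orthonormal by (intro has_bochner_integral_gauss_measure_prod) auto
  moreover have "(\<Prod>j<d. if k j = l j then 1 else 0) = (if k = l then 1 else 0 :: real)"
  proof (cases "k = l")
    case False
    then obtain j where "j < d" "k j \<noteq> l j"
      using assms(2,3) unfolding multi_indices_def by (metis PiE_ext lessThan_iff)
    then show ?thesis using False by (auto intro: prod_zero)
  qed simp
  ultimately show ?thesis
    by (elim has_bochner_integral_gauss_measure_cong) (simp_all add: tensor_eigenfun_def prod.distrib)
qed

lemma tensor_eigenfun_measurable [measurable]:
  "tensor_eigenfun a d k \<in> borel_measurable (gauss_measure d)"
proof -
  have "(\<lambda>x. \<Prod>j<d. eigenfun a (k j) (x j)) \<in> borel_measurable (\<Pi>\<^sub>M j\<in>{..<d}. lborel)"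
    by measurable
  then have "(\<lambda>x. \<Prod>j<d. eigenfun a (k j) (x j)) \<in> borel_measurable (gauss_measure d)"
    by (simp add: gauss_measure_def)
  then show ?thesis
    by (subst measurable_cong[of _ _ "\<lambda>x. \<Prod>j<d. eigenfun a (k j) (x j)"])
      (auto simp: space_gauss_measure tensor_eigenfun_def)
qed

lemma tensor_eigenfun_equation:
  assumes "0 \<le> a" "\<gamma>\<^sup>2 = a + a\<^sup>2" "t \<in> Rd d"
  shows "(LINT s|gauss_measure d. gauss_kernel \<gamma> d t s * tensor_eigenfun a d k s)
    = tensor_eigenvalue a d k * tensor_eigenfun a d k t"
proof -
  have "has_bochner_integral (gauss_measure d)
      (\<lambda>s. \<Prod>j<d. exp (- (a + a\<^sup>2) * (t j - s j)\<^sup>2) * eigenfun a (k j) (s j))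
      (\<Prod>j<d. 1 / (1 + a) * (a / (1 + a)) ^ k j * eigenfun a (k j) (t j))"
    using assms(1) eigenfun_equation by (intro has_bochner_integral_gauss_measure_prod) auto
  then have "has_bochner_integral (gauss_measure d)
      (\<lambda>s. gauss_kernel \<gamma> d t s * tensor_eigenfun a d k s)
      (tensor_eigenvalue a d k * tensor_eigenfun a d k t)"
    using assms(2,3) by (elim has_bochner_integral_gauss_measure_cong)
      (simp_all add: tensor_eigenfun_def gauss_kernel_def tensor_eigenvalue_prod prod.distrib
        prod_dividef)
  then show ?thesis by (simp add: has_bochner_integral_iff)
qed


section \<open>Counting multi-indices\<close>

lemma finite_multi_indices_sum_le: "finite {k \<in> multi_indices d. (\<Sum>j<d. k j) \<le> N}"
proof (rule finite_subset)
  show "{k \<in> multi_indices d. (\<Sum>j<d. k j) \<le> N} \<subseteq> {..<d} \<rightarrow>\<^sub>E {..N}"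
  proof
    fix k assume k: "k \<in> {k \<in> multi_indices d. (\<Sum>j<d. k j) \<le> N}"
    have "k j \<le> N" if "j < d" for j
      using member_le_sum[of j "{..<d}" k] that k by simp
    then show "k \<in> {..<d} \<rightarrow>\<^sub>E {..N}" using k by (auto simp: multi_indices_def PiE_def)
  qed
qed (intro finite_PiE, auto)

text \<open>
  Stars and bars: the slack \<open>N - \<bar>k\<bar>\<close>, put in front of \<open>k\<close>, turns the multi-index into a list of
  length \<open>d + 1\<close> with sum \<open>N\<close>.
\<close>

lemma card_multi_indices_sum_le:
  "card {k \<in> multi_indices d. (\<Sum>j<d. k j) \<le> N} = (N + d) choose N"
proof -
  let ?A = "{k \<in> multi_indices d. (\<Sum>j<d. k j) \<le> N}"
  let ?B = "{l :: nat list. length l = Suc d \<and> sum_list l = N}"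
  have "bij_betw (\<lambda>k. (N - (\<Sum>j<d. k j)) # map k [0..<d]) ?A ?B"
  proof (rule bij_betw_byWitness[where f' = "\<lambda>l. \<lambda>j\<in>{..<d}. l ! Suc j"])
    show "\<forall>k\<in>?A. (\<lambda>j\<in>{..<d}. ((N - (\<Sum>j<d. k j)) # map k [0..<d]) ! Suc j) = k"
    proof (intro ballI ext)
      fix k j assume "k \<in> ?A"
      then have "k j = undefined" if "\<not> j < d"
        using that PiE_arb[of k "{..<d}" "\<lambda>_. UNIV" j] by (simp add: multi_indices_def)
      then show "(\<lambda>j\<in>{..<d}. ((N - (\<Sum>j<d. k j)) # map k [0..<d]) ! Suc j) j = k j"
        by (cases "j < d") auto
    qed
    have tail: "(\<Sum>j<d. l ! Suc j) = N - l ! 0 \<and> l ! 0 \<le> N" if "l \<in> ?B" for l :: "nat list"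
    proof -
      have "N = (\<Sum>i<Suc d. l ! i)" using that by (auto simp: sum_list_sum_nth atLeast0LessThan)
      also have "\<dots> = l ! 0 + (\<Sum>j<d. l ! Suc j)" by (rule sum.lessThan_Suc_shift)
      finally show ?thesis by simp
    qed
    show "\<forall>l\<in>?B. (N - (\<Sum>j<d. (\<lambda>j\<in>{..<d}. l ! Suc j) j)) # map (\<lambda>j\<in>{..<d}. l ! Suc j) [0..<d] = l"
    proof
      fix l assume l: "l \<in> ?B"
      show "(N - (\<Sum>j<d. (\<lambda>j\<in>{..<d}. l ! Suc j) j)) # map (\<lambda>j\<in>{..<d}. l ! Suc j) [0..<d] = l"
        using tail[OF l] l by (intro nth_equalityI) (auto simp: nth_Cons split: nat.split)
    qed
    show "(\<lambda>k. (N - (\<Sum>j<d. k j)) # map k [0..<d]) ` ?A \<subseteq> ?B"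
      by (auto simp: interv_sum_list_conv_sum_set_nat atLeast0LessThan)
    show "(\<lambda>l. \<lambda>j\<in>{..<d}. l ! Suc j) ` ?B \<subseteq> ?A"
      using tail by (auto simp: multi_indices_def split: if_splits)
  qed
  then have "card ?A = card ?B" by (rule bij_betw_same_card)
  also have "\<dots> = (N + d) choose N" using card_length_sum_list[of "Suc d" N] by simp
  finally show ?thesis .
qed


section \<open>The Gaussian reproducing kernel Hilbert space\<close>

locale gaussian_rkhs = rkhs "Rd d" H ip "gauss_kernel \<gamma> d" for \<gamma> d H ip +
  fixes a :: real
  assumes a_pos: "0 < a" and \<gamma>_eq: "\<gamma>\<^sup>2 = a + a\<^sup>2"
begin

lemma gauss_kernel_self: "gauss_kernel \<gamma> d x x = 1"
  by (simp add: gauss_kernel_def)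

lemma gauss_kernel_commute: "gauss_kernel \<gamma> d x y = gauss_kernel \<gamma> d y x"
  by (simp add: gauss_kernel_def power2_commute)

lemma increment_square_le:
  assumes f: "f \<in> H" and x: "x \<in> Rd d" and y: "y \<in> Rd d"
  shows "(f x - f y)\<^sup>2 \<le> ip f f * (2 - 2 * gauss_kernel \<gamma> d x y)"
proof -
  let ?k = "\<lambda>s t. if t \<in> Rd d then gauss_kernel \<gamma> d t s else 0"
  have k: "?k x \<in> H" "?k y \<in> H" using x y by (simp_all only: kernel_mem)
  have d: "(\<lambda>t. ?k x t - ?k y t) \<in> H" using k by (rule diff_closed)
  have "ip f (\<lambda>t. ?k x t - ?k y t) = ip (\<lambda>t. ?k x t - ?k y t) f" using f d by (rule ip_commute)
  also have "\<dots> = ip (?k x) f - ip (?k y) f" using k f by (rule ip_diff_left)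
  also have "\<dots> = f x - f y"
    using reproducing[OF x f] reproducing[OF y f] ip_commute[OF f k(1)] ip_commute[OF f k(2)] by simp
  finally have "f x - f y = ip f (\<lambda>t. ?k x t - ?k y t)" ..
  moreover have "ip (\<lambda>t. ?k x t - ?k y t) (\<lambda>t. ?k x t - ?k y t) = 2 - 2 * gauss_kernel \<gamma> d x y"
    using ip_diff_self[OF k] reproducing[OF x k(1)] reproducing[OF y k(2)] reproducing[OF y k(1)] x y
    by (simp add: gauss_kernel_self gauss_kernel_commute[of y x])
  ultimately show ?thesis using cauchy_schwarz[OF f d] by simp
qed

text \<open>
  The elements of \<open>H\<close> are continuous by \<open>increment_square_le\<close>. Continuity refers to the product
  topology on all sequences, where Borel sets and product measurable sets agree, so \<open>f\<close> is extended
  to sequences as a function of the first \<open>d\<close> coordinates.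
\<close>

lemma gaussian_rkhs_measurable:
  assumes f: "f \<in> H"
  shows "f \<in> borel_measurable (gauss_measure d)"
proof -
  define g where "g x = f (restrict x {..<d})" for x :: "nat \<Rightarrow> real"
  have restrict: "restrict x {..<d} \<in> Rd d" for x :: "nat \<Rightarrow> real" by (simp add: Rd_def)
  have "isCont g x" for x
  proof -
    have "continuous_on UNIV (\<lambda>y. gauss_kernel \<gamma> d y x)"
      unfolding gauss_kernel_def
      by (intro continuous_intros continuous_on_product_coordinates)
    then have "isCont (\<lambda>y. gauss_kernel \<gamma> d y x) x"
      by (simp add: continuous_on_eq_continuous_at)
    then have "(\<lambda>y. gauss_kernel \<gamma> d y x) \<midarrow>x\<rightarrow> 1" by (simp add: isCont_def gauss_kernel_self)
    then have "(\<lambda>y. sqrt (ip f f * (2 - 2 * gauss_kernel \<gamma> d y x))) \<midarrow>x\<rightarrow> sqrt (ip f f * (2 - 2 * 1))"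
      by (intro tendsto_intros)
    then have lim: "(\<lambda>y. sqrt (ip f f * (2 - 2 * gauss_kernel \<gamma> d y x))) \<midarrow>x\<rightarrow> 0" by simp
    have "gauss_kernel \<gamma> d (restrict y {..<d}) (restrict x {..<d}) = gauss_kernel \<gamma> d y x" for y
      by (simp add: gauss_kernel_def)
    then have "norm (g y - g x) \<le> sqrt (ip f f * (2 - 2 * gauss_kernel \<gamma> d y x))" for y
      using increment_square_le[OF f restrict restrict, of y x]
      by (simp add: g_def real_le_rsqrt)
    then have "(\<lambda>y. g y - g x) \<midarrow>x\<rightarrow> 0"
      by (intro Lim_null_comparison[OF _ lim]) auto
    then show ?thesis by (simp add: isCont_def LIM_zero_iff)
  qed
  then have "continuous_on UNIV g" by (simp add: continuous_at_imp_continuous_on)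
  then have "g \<in> borel_measurable borel" by (rule borel_measurable_continuous_onI)
  then have g: "g \<in> borel_measurable (Pi\<^sub>M UNIV (\<lambda>_. borel))"
    by (simp add: sets_PiM_equal_borel cong: measurable_cong_sets)
  have "(\<lambda>x i. if i < d then x i else 0) \<in> (\<Pi>\<^sub>M j\<in>{..<d}. lborel) \<rightarrow>\<^sub>M (\<Pi>\<^sub>M j\<in>UNIV. borel :: real measure)"
  proof (rule measurable_PiM_single')
    show "(\<lambda>x. if i < d then x i else 0) \<in> borel_measurable (\<Pi>\<^sub>M j\<in>{..<d}. lborel)" for i
      by (cases "i < d") (auto intro!: measurable_component_singleton)
  qed auto
  from measurable_compose[OF this g]
  have "(\<lambda>x. g (\<lambda>i. if i < d then x i else 0)) \<in> borel_measurable (gauss_measure d)"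
    by (simp add: sets_gauss_measure cong: measurable_cong_sets)
  moreover have "g (\<lambda>i. if i < d then x i else 0) = f x" if "x \<in> Rd d" for x
  proof -
    have "restrict (\<lambda>i. if i < d then x i else 0) {..<d} = x"
      using that PiE_arb[of x "{..<d}" "\<lambda>_. UNIV"] by (auto simp: Rd_def)
    then show ?thesis by (simp add: g_def)
  qed
  ultimately show ?thesis
    by (subst measurable_cong[of _ _ "\<lambda>x. g (\<lambda>i. if i < d then x i else 0)"])
      (auto simp: space_gauss_measure)
qed

lemma gauss_measure_total: "has_bochner_integral (gauss_measure d) (\<lambda>x. 1) (1::real)"
  using has_bochner_integral_gauss_measure_prod[of "\<lambda>_ _. 1" d "\<lambda>_. 1"] gaussian_moment_even[of 0]
  by simp

text \<open>
  Over the box \<open>k j < m\<close> the eigenvalues factorise into \<open>d\<close> truncated geometric series.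
\<close>

lemma gauss_trace_exhausted:
  assumes "0 < e"
  shows "\<exists>J\<subseteq>multi_indices d. finite J \<and> 1 - e < sum (tensor_eigenvalue a d) J"
proof -
  define w where "w = a / (1 + a)"
  have w: "0 \<le> w" "w < 1" and w1: "1 / (1 + a) = 1 - w" using a_pos by (simp_all add: w_def field_simps)
  have sum_box: "sum (tensor_eigenvalue a d) ({..<d} \<rightarrow>\<^sub>E {..<m}) = (1 - w ^ m) ^ d" for m
  proof -
    have "(\<Prod>j<d. \<Sum>i<m. (1 - w) * w ^ i) = (\<Sum>k\<in>{..<d} \<rightarrow>\<^sub>E {..<m}. \<Prod>j<d. (1 - w) * w ^ k j)"
      by (rule prod_sum_PiE) auto
    moreover have "(\<Sum>i<m. (1 - w) * w ^ i) = 1 - w ^ m"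
      using one_diff_power_eq[of w m] by (simp add: sum_distrib_left)
    ultimately show ?thesis
      by (simp add: tensor_eigenvalue_prod w1 flip: w_def)
  qed
  have "(\<lambda>m. (1 - w ^ m) ^ d) \<longlonglongrightarrow> (1 - 0) ^ d"
    using w by (intro tendsto_intros LIMSEQ_realpow_zero)
  then have "eventually (\<lambda>m. 1 - e < (1 - w ^ m) ^ d) sequentially"
    using assms by (auto dest!: order_tendstoD(1)[where a = "1 - e"])
  then obtain m where "1 - e < (1 - w ^ m) ^ d" by (auto simp: eventually_sequentially)
  then show ?thesis
    using sum_box[of m] by (intro exI[of _ "{..<d} \<rightarrow>\<^sub>E {..<m}"])
      (auto simp: multi_indices_def finite_PiE)
qed

sublocale rkhs_eigensystem "Rd d" H ip "gauss_kernel \<gamma> d" "gauss_measure d" "multi_indices d"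
  "tensor_eigenfun a d" "tensor_eigenvalue a d"
proof
  show "0 < tensor_eigenvalue a d k" for k using a_pos by (simp add: tensor_eigenvalue_def)
  fix k l assume k: "k \<in> multi_indices d" and l: "l \<in> multi_indices d"
  show "(LINT x|gauss_measure d. tensor_eigenfun a d k x * tensor_eigenfun a d l x)
      = (if k = l then 1 else 0)"
    using tensor_eigenfun_orthonormal[OF _ k l] a_pos by (simp add: has_bochner_integral_iff)
next
  fix k assume k: "k \<in> multi_indices d"
  show "integrable (gauss_measure d) (\<lambda>x. (tensor_eigenfun a d k x)\<^sup>2)"
    using tensor_eigenfun_orthonormal[OF _ k k] a_pos
    by (simp add: has_bochner_integral_iff power2_eq_square)
next
  fix e :: real assume "0 < e"
  then show "\<exists>J\<subseteq>multi_indices d. finite J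
      \<and> (LINT x|gauss_measure d. gauss_kernel \<gamma> d x x) - e < sum (tensor_eigenvalue a d) J"
    using gauss_trace_exhausted gauss_measure_total
    by (simp add: gauss_kernel_self has_bochner_integral_iff)
qed (use gaussian_rkhs_measurable gauss_measure_total tensor_eigenfun_equation a_pos \<gamma>_eq in
    \<open>auto simp: space_gauss_measure gauss_kernel_self has_bochner_integral_iff tensor_eigenfun_def\<close>)

lemma hball_bound: "f \<in> hball H ip \<Longrightarrow> f \<in> H" "f \<in> hball H ip \<Longrightarrow> ip f f \<le> 1"
  using ip_nonneg by (auto simp: hball_def hnorm_def)

lemma zero_in_hball: "(\<lambda>x. 0) \<in> hball H ip"
  using zero_closed by (simp add: hball_def hnorm_def ip_zero_left)

text \<open>
  The supremum in the definition of the worst case error is a real supremum and so bounds the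
  single errors only if they are bounded.
\<close>

lemma algorithm_error_bdd_above:
  assumes "A \<in> linear_algorithms H ip d n"
  shows "bdd_above ((\<lambda>f. L2_norm d (\<lambda>x. f x - A f x)) ` hball H ip)"
proof -
  obtain b l where bl: "\<And>k. k \<in> {1..n} \<Longrightarrow> b k \<in> L2 d \<and> l k \<in> hdual H ip"
    and A: "A = (\<lambda>f x. \<Sum>k=1..n. b k x * l k f)"
    using assms unfolding linear_algorithms_def by blast
  have "\<exists>C. \<forall>f\<in>H. \<bar>l k f\<bar> \<le> C * hnorm ip f" if "k \<in> {1..n}" for k
    using bl[OF that] by (auto simp: hdual_def)
  then obtain C where C: "\<And>k f. k \<in> {1..n} \<Longrightarrow> f \<in> H \<Longrightarrow> \<bar>l k f\<bar> \<le> C k * hnorm ip f" by metis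
  let ?M = "gauss_measure d"
  have int_b: "integrable ?M (\<lambda>x. (b k x)\<^sup>2)" if "k \<in> {1..n}" for k
    using bl[OF that] by (simp add: L2_def)
  define B where "B x = 2 * real n * (\<Sum>k=1..n. (C k)\<^sup>2 * (b k x)\<^sup>2)" for x
  have int_B: "integrable ?M B" unfolding B_def using int_b by auto
  have B_nonneg: "0 \<le> B x" for x by (auto simp: B_def intro!: mult_nonneg_nonneg sum_nonneg)
  have "L2_norm d (\<lambda>x. f x - A f x) \<le> sqrt (2 + (LINT x|?M. B x))" if f: "f \<in> hball H ip" for f
  proof -
    have fH: "f \<in> H" and norm: "hnorm ip f \<le> 1" using f by (auto simp: hball_def)
    have "(f x - A f x)\<^sup>2 \<le> 2 * (f x)\<^sup>2 + B x" for x
    proof -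
      have "(A f x)\<^sup>2 \<le> (\<Sum>k=1..n. (b k x * l k f)\<^sup>2) * real n"
        using sum_squared_le_sum_of_squares[of "\<lambda>k. b k x * l k f" "{1..n}"] by (simp add: A)
      also have "(\<Sum>k=1..n. (b k x * l k f)\<^sup>2) \<le> (\<Sum>k=1..n. (C k)\<^sup>2 * (b k x)\<^sup>2)"
      proof (rule sum_mono)
        fix k assume k: "k \<in> {1..n}"
        have n0: "0 \<le> hnorm ip f" by (simp add: hnorm_def ip_nonneg fH)
        have "\<bar>l k f\<bar> \<le> \<bar>C k\<bar> * hnorm ip f"
          using C[OF k fH] n0 by (meson abs_ge_self mult_right_mono order_trans)
        also have "\<dots> \<le> \<bar>C k\<bar> * 1" using norm by (intro mult_left_mono) auto
        finally have "(l k f)\<^sup>2 \<le> (C k)\<^sup>2" by (simp add: abs_le_square_iff)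
        then have "(l k f)\<^sup>2 * (b k x)\<^sup>2 \<le> (C k)\<^sup>2 * (b k x)\<^sup>2" by (intro mult_right_mono) auto
        then show "(b k x * l k f)\<^sup>2 \<le> (C k)\<^sup>2 * (b k x)\<^sup>2"
          by (simp add: power_mult_distrib mult.commute)
      qed
      finally have "2 * (A f x)\<^sup>2 \<le> B x" by (simp add: B_def mult_right_mono mult_ac)
      moreover have "(f x - A f x)\<^sup>2 \<le> 2 * (f x)\<^sup>2 + 2 * (A f x)\<^sup>2"
        using zero_le_power2[of "f x + A f x"] by (simp add: power2_sum power2_diff)
      ultimately show ?thesis by linarith
    qed
    then have "(LINT x|?M. (f x - A f x)\<^sup>2) \<le> (LINT x|?M. 2 * (f x)\<^sup>2 + B x)"
      using integrable_square[OF fH] int_B B_nonneg by (intro integral_mono') auto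
    also have "\<dots> = 2 * (LINT x|?M. (f x)\<^sup>2) + (LINT x|?M. B x)"
      using integrable_square[OF fH] int_B by simp
    also have "(LINT x|?M. (f x)\<^sup>2) \<le> 1"
      using integral_square_le[OF fH] hball_bound(2)[OF f] gauss_measure_total
      by (simp add: gauss_kernel_self has_bochner_integral_iff)
    finally show ?thesis by (simp add: L2_norm_def)
  qed
  then show ?thesis by (intro bdd_aboveI2)
qed

lemma zero_algorithm: "(\<lambda>f x. 0) \<in> linear_algorithms H ip d n"
  unfolding linear_algorithms_def
  by (intro CollectI exI[of _ "\<lambda>_ _. 0"] conjI)
    (auto simp: L2_def hdual_def intro!: exI[of _ 0])

lemma worst_case_error_nonneg:
  assumes "A \<in> linear_algorithms H ip d n"
  shows "0 \<le> (SUP f\<in>hball H ip. L2_norm d (\<lambda>x. f x - A f x))"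
  by (rule cSUP_upper2[OF algorithm_error_bdd_above[OF assms] zero_in_hball]) (simp add: L2_norm_def)

text \<open>
  The function from \<open>exists_in_kernel_of_functionals\<close> is invisible to the algorithm, whose error is
  then the \<open>L\<^sub>2\<close> norm of that function.
\<close>

lemma min_error_ge:
  assumes I: "finite I" "I \<subseteq> multi_indices d" "n < card I"
    and large: "\<And>k. k \<in> I \<Longrightarrow> \<Lambda> \<le> tensor_eigenvalue a d k"
  shows "sqrt \<Lambda> \<le> min_error H ip d n"
  unfolding min_error_def
proof (rule cINF_greatest)
  show "linear_algorithms H ip d n \<noteq> {}" using zero_algorithm by blast
  fix A assume A: "A \<in> linear_algorithms H ip d n"
  then obtain b l where l: "\<And>k. k \<in> {1..n} \<Longrightarrow> l k \<in> hdual H ip"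
    and A_eq: "A = (\<lambda>f x. \<Sum>k=1..n. b k x * l k f)"
    unfolding linear_algorithms_def by blast
  obtain f where f: "f \<in> hball H ip" and ker: "\<And>k. k \<in> {1..n} \<Longrightarrow> l k f = 0"
    and "\<Lambda> \<le> (LINT x|gauss_measure d. (f x)\<^sup>2)"
    using exists_in_kernel_of_functionals[where l = l, OF I l large] by blast
  then have "sqrt \<Lambda> \<le> L2_norm d (\<lambda>x. f x - A f x)" by (simp add: A_eq L2_norm_def)
  then show "sqrt \<Lambda> \<le> (SUP f\<in>hball H ip. L2_norm d (\<lambda>x. f x - A f x))"
    by (rule cSUP_upper2[OF algorithm_error_bdd_above[OF A] f])
qed

lemma coef_in_hdual:
  assumes k: "k \<in> multi_indices d"
  shows "(\<lambda>f. coef f k) \<in> hdual H ip"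
proof -
  let ?\<phi> = "tensor_eigenfun a d k" and ?m = "tensor_eigenvalue a d k"
  have "\<bar>coef f k\<bar> \<le> ?m * hnorm ip ?\<phi> * hnorm ip f" if f: "f \<in> H" for f
    using abs_ip_le[OF f \<phi>_mem[OF k]] lam_pos[OF k]
    by (simp add: coef_eq[OF k f] abs_mult mult.commute mult.left_commute)
  moreover have "coef (\<lambda>x. f x + g x) k = coef f k + coef g k" if "f \<in> H" "g \<in> H" for f g
    using that by (simp add: coef_eq[OF k] add_closed ip_add_left \<phi>_mem[OF k] distrib_left)
  moreover have "coef (\<lambda>x. c * f x) k = c * coef f k" if "f \<in> H" for c f
    using that by (simp add: coef_eq[OF k] scale_closed ip_scale_left \<phi>_mem[OF k])
  ultimately show ?thesis by (auto simp: hdual_def)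
qed

lemma min_error_le:
  assumes I: "finite I" "I \<subseteq> multi_indices d" "card I = n"
    and tail: "\<And>k. k \<in> multi_indices d - I \<Longrightarrow> tensor_eigenvalue a d k \<le> \<Lambda>" and "0 \<le> \<Lambda>"
  shows "min_error H ip d n \<le> sqrt \<Lambda>"
proof -
  obtain h where h: "bij_betw h {1..n} I"
    using ex_bij_betw_nat_finite_1[OF I(1)] I(3) by blast
  have A: "proj I = (\<lambda>f x. \<Sum>i=1..n. tensor_eigenfun a d (h i) x * coef f (h i))"
  proof (intro ext)
    fix f x
    show "proj I f x = (\<Sum>i=1..n. tensor_eigenfun a d (h i) x * coef f (h i))"
      unfolding proj_def
      using sum.reindex_bij_betw[OF h, of "\<lambda>k. coef f k * tensor_eigenfun a d k x"]
      by (simp add: mult.commute)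
  qed
  have hI: "h i \<in> multi_indices d" if "i \<in> {1..n}" for i
    using bij_betw_apply[OF h that] I(2) by blast
  have "tensor_eigenfun a d (h i) \<in> L2 d" if "i \<in> {1..n}" for i
    using \<phi>_integrable_square[OF hI[OF that]] by (simp add: L2_def)
  then have mem: "proj I \<in> linear_algorithms H ip d n"
    unfolding linear_algorithms_def A using hI coef_in_hdual
    by (intro CollectI exI[of _ "\<lambda>i. tensor_eigenfun a d (h i)"] exI[of _ "\<lambda>i f. coef f (h i)"]) auto
  have "(SUP f\<in>hball H ip. L2_norm d (\<lambda>x. f x - proj I f x)) \<le> sqrt \<Lambda>"
  proof (rule cSUP_least)
    show "hball H ip \<noteq> {}" using zero_in_hball by blast
    fix f assume f: "f \<in> hball H ip"
    have "(LINT x|gauss_measure d. (f x - proj I f x)\<^sup>2) \<le> \<Lambda> * ip f f"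
      using hball_bound(1)[OF f] I tail \<open>0 \<le> \<Lambda>\<close> by (intro projection_error) auto
    also have "\<dots> \<le> \<Lambda> * 1" using hball_bound(2)[OF f] \<open>0 \<le> \<Lambda>\<close> by (intro mult_left_mono)
    finally show "L2_norm d (\<lambda>x. f x - proj I f x) \<le> sqrt \<Lambda>" by (simp add: L2_norm_def)
  qed
  moreover have "bdd_below ((\<lambda>A. SUP f\<in>hball H ip. L2_norm d (\<lambda>x. f x - A f x)) ` linear_algorithms H ip d n)"
    using worst_case_error_nonneg by (intro bdd_belowI2)
  ultimately show ?thesis
    unfolding min_error_def using mem by (rule_tac cINF_lower2)
qed

text \<open>
  Without any functionals the only algorithm is zero, so the bounds for the minimal errors also give
  the initial error.
\<close>

lemma initial_error_eq_min_error: "initial_error H ip d = min_error H ip d 0"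
proof -
  have "linear_algorithms H ip d 0 = {\<lambda>f x. 0}" by (auto simp: linear_algorithms_def)
  then show ?thesis by (simp add: initial_error_def min_error_def)
qed

lemma tensor_eigenvalue_ge:
  assumes "(\<Sum>j<d. k j) \<le> m"
  shows "(1 / (1 + a)) ^ d * (a / (1 + a)) ^ m \<le> tensor_eigenvalue a d k"
  unfolding tensor_eigenvalue_def using assms a_pos
  by (intro mult_left_mono power_decreasing) auto

lemma tensor_eigenvalue_le:
  assumes "m \<le> (\<Sum>j<d. k j)"
  shows "tensor_eigenvalue a d k \<le> (1 / (1 + a)) ^ d * (a / (1 + a)) ^ m"
  unfolding tensor_eigenvalue_def using assms a_pos
  by (intro mult_left_mono power_decreasing) auto

lemma initial_error_eq: "initial_error H ip d = sqrt ((1 / (1 + a)) ^ d)"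
  unfolding initial_error_eq_min_error
proof (rule antisym)
  show "min_error H ip d 0 \<le> sqrt ((1 / (1 + a)) ^ d)"
    using tensor_eigenvalue_le[of 0] a_pos by (intro min_error_le[of "{}"]) auto
  have "sqrt ((1 / (1 + a)) ^ d * (a / (1 + a)) ^ 0) \<le> min_error H ip d 0"
    using finite_multi_indices_sum_le[of d 0] card_multi_indices_sum_le[of d 0] tensor_eigenvalue_ge[of _ 0]
    by (intro min_error_ge[of "{k \<in> multi_indices d. (\<Sum>j<d. k j) \<le> 0}"]) auto
  then show "sqrt ((1 / (1 + a)) ^ d) \<le> min_error H ip d 0" by simp
qed

text \<open>
  Sorting the eigenvalues by \<open>\<bar>k\<bar>\<close>: those with \<open>\<bar>k\<bar> \<le> N\<close> are too large to be ignored, and all others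
  are at most \<open>\<epsilon>\<^sup>2\<close> times the largest eigenvalue.
\<close>

theorem info_complexity_eq:
  assumes "0 < \<epsilon>" and low: "(a / (1 + a)) ^ Suc N \<le> \<epsilon>\<^sup>2" and high: "\<epsilon>\<^sup>2 < (a / (1 + a)) ^ N"
  shows "info_complexity H ip d \<epsilon> = (N + d) choose N"
  unfolding info_complexity_def
proof (rule Least_equality)
  let ?I = "{k \<in> multi_indices d. (\<Sum>j<d. k j) \<le> N}"
  note card = card_multi_indices_sum_le[of d N]
  define L0 where "L0 = (1 / (1 + a)) ^ d"
  have L0: "0 < L0" using a_pos by (simp add: L0_def)
  have target: "\<epsilon> * initial_error H ip d = sqrt (L0 * \<epsilon>\<^sup>2)"
    using \<open>0 < \<epsilon>\<close> by (simp add: initial_error_eq L0_def real_sqrt_mult)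
  have "min_error H ip d ((N + d) choose N) \<le> sqrt (L0 * (a / (1 + a)) ^ Suc N)"
    unfolding L0_def
  proof (rule min_error_le[of ?I])
    show "tensor_eigenvalue a d k \<le> (1 / (1 + a)) ^ d * (a / (1 + a)) ^ Suc N"
      if "k \<in> multi_indices d - ?I" for k
      using that by (intro tensor_eigenvalue_le) auto
  qed (use finite_multi_indices_sum_le card a_pos in auto)
  also have "\<dots> \<le> sqrt (L0 * \<epsilon>\<^sup>2)"
    using L0 low by (intro real_sqrt_le_mono mult_left_mono) auto
  finally show "1 \<le> (N + d) choose N \<and> min_error H ip d ((N + d) choose N) \<le> \<epsilon> * initial_error H ip d"
    using zero_less_binomial[of N "N + d"] unfolding target by (simp add: Suc_le_eq)
  fix n assume n: "1 \<le> n \<and> min_error H ip d n \<le> \<epsilon> * initial_error H ip d"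
  show "(N + d) choose N \<le> n"
  proof (rule ccontr)
    assume "\<not> (N + d) choose N \<le> n"
    then have "sqrt (L0 * (a / (1 + a)) ^ N) \<le> min_error H ip d n"
      unfolding L0_def using finite_multi_indices_sum_le card tensor_eigenvalue_ge
      by (intro min_error_ge[of ?I]) auto
    moreover have "sqrt (L0 * \<epsilon>\<^sup>2) < sqrt (L0 * (a / (1 + a)) ^ N)"
      using L0 high by (intro real_sqrt_less_mono mult_strict_left_mono)
    ultimately show False using n target by simp
  qed
qed

end


section \<open>Asymptotics\<close>

text \<open>
  The integer exponent keeps the claim meaningful for \<open>N = 0\<close>, where the difference vanishes.
\<close>

lemma pochhammer_minus_power_bigo:
  "(\<lambda>d. pochhammer (real d + 1) N - real d ^ N) \<in> O(\<lambda>d. real d powi (int N - 1))"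
proof (induction N)
  case (Suc N)
  have "(\<lambda>d. (pochhammer (real d + 1) N - real d ^ N) * (real d + 1 + real N))
      \<in> O(\<lambda>d. real d powi (int N - 1) * real d)"
    by (intro landau_o.big.mult Suc.IH) real_asymp
  also have "(\<lambda>d. real d powi (int N - 1) * real d) \<in> \<Theta>(\<lambda>d. real d powi (int (Suc N) - 1))"
    by (intro bigthetaI_cong eventually_mono[OF eventually_gt_at_top[of 0]])
      (auto simp: power_int_diff power_int_add)
  finally have "(\<lambda>d. (pochhammer (real d + 1) N - real d ^ N) * (real d + 1 + real N))
      \<in> O(\<lambda>d. real d powi (int (Suc N) - 1))" .
  moreover have "(\<lambda>d. (1 + real N) * real d ^ N) \<in> O(\<lambda>d. real d powi (int (Suc N) - 1))"
    by simp
  ultimately have "(\<lambda>d. (pochhammer (real d + 1) N - real d ^ N) * (real d + 1 + real N)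
      + (1 + real N) * real d ^ N) \<in> O(\<lambda>d. real d powi (int (Suc N) - 1))"
    by (rule sum_in_bigo)
  then show ?case by (simp add: pochhammer_Suc algebra_simps)
qed simp

lemma binomial_eq_pochhammer: "real ((N + d) choose N) = pochhammer (real d + 1) N / fact N"
  by (simp add: binomial_gbinomial gbinomial_pochhammer' add.commute)

text \<open>
  The parameter \<open>a\<close> is the positive root of \<open>a\<^sup>2 + a = \<gamma>\<^sup>2\<close>; then \<open>sqrt (1 + 4 * \<gamma>\<^sup>2) = 1 + 2 * a\<close>.
\<close>

lemma omega_parametrization:
  assumes "0 < \<gamma>"
  obtains a where "0 < a" "\<gamma>\<^sup>2 = a + a\<^sup>2" "omega \<gamma> = a / (1 + a)"
proof
  define r where "r = sqrt (1 + 4 * \<gamma>\<^sup>2)"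
  define a where "a = (r - 1) / 2"
  have r: "1 < r" "r\<^sup>2 = 1 + 4 * \<gamma>\<^sup>2" using assms by (simp_all add: r_def)
  show "0 < (r - 1) / 2" using r by simp
  show \<gamma>: "\<gamma>\<^sup>2 = (r - 1) / 2 + ((r - 1) / 2)\<^sup>2" using r(2) by (simp add: power2_eq_square field_simps)
  have a: "0 < a" "\<gamma>\<^sup>2 = a + a\<^sup>2" "r = 1 + 2 * a" using r \<gamma> by (simp_all only: a_def) (simp_all add: field_simps)
  have "omega \<gamma> = 2 * (a + a\<^sup>2) / (1 + 2 * (a + a\<^sup>2) + (1 + 2 * a))"
    unfolding omega_def r_def[symmetric] by (simp only: a(2,3))
  also have "\<dots> = a * (2 * (1 + a)) / ((1 + a) * (2 * (1 + a)))"
    by (simp add: power2_eq_square algebra_simps)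
  also have "\<dots> = a / (1 + a)" using a(1) by (subst mult_divide_mult_cancel_right) auto
  finally show "omega \<gamma> = (r - 1) / 2 / (1 + (r - 1) / 2)" by (simp add: a_def)
qed

text \<open>
  Taking logarithms, \<open>m < c_omega \<gamma> * \<bar>ln (\<epsilon>\<^sup>2)\<bar>\<close> means \<open>\<epsilon>\<^sup>2 < omega \<gamma> ^ m\<close>.
\<close>

lemma N_omega_bounds:
  assumes w: "0 < omega \<gamma>" "omega \<gamma> < 1" and \<epsilon>: "0 < \<epsilon>" "\<epsilon> < 1"
  shows "omega \<gamma> ^ Suc (N_omega \<gamma> \<epsilon>) \<le> \<epsilon>\<^sup>2" and "\<epsilon>\<^sup>2 < omega \<gamma> ^ N_omega \<gamma> \<epsilon>"
proof -
  let ?w = "omega \<gamma>" and ?N = "N_omega \<gamma> \<epsilon>"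
  have lnw: "ln ?w < 0" and ln\<epsilon>: "ln (\<epsilon>\<^sup>2) < 0" using w \<epsilon> by (simp_all add: ln_realpow)
  have iff: "real m < c_omega \<gamma> * \<bar>ln (\<epsilon>\<^sup>2)\<bar> \<longleftrightarrow> \<epsilon>\<^sup>2 < ?w ^ m" for m
  proof -
    have "real m < c_omega \<gamma> * \<bar>ln (\<epsilon>\<^sup>2)\<bar> \<longleftrightarrow> ln (\<epsilon>\<^sup>2) < real m * ln ?w"
      using lnw ln\<epsilon> by (simp add: c_omega_def field_simps)
    also have "\<dots> \<longleftrightarrow> ln (\<epsilon>\<^sup>2) < ln (?w ^ m)" using w by (simp add: ln_realpow)
    also have "\<dots> \<longleftrightarrow> \<epsilon>\<^sup>2 < ?w ^ m" using w \<epsilon> by (subst ln_less_cancel_iff) auto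
    finally show ?thesis .
  qed
  let ?S = "{m. real m < c_omega \<gamma> * \<bar>ln (\<epsilon>\<^sup>2)\<bar>}"
  have fin: "finite ?S"
  proof (rule finite_subset)
    show "?S \<subseteq> {..nat \<lceil>c_omega \<gamma> * \<bar>ln (\<epsilon>\<^sup>2)\<bar>\<rceil>}" by (auto simp: le_nat_iff) linarith
  qed simp
  have "0 \<in> ?S" using iff[of 0] \<epsilon> power_strict_mono[of \<epsilon> 1 2] by simp
  then have "?N \<in> ?S" unfolding N_omega_def using Max_in[OF fin] by blast
  then show "\<epsilon>\<^sup>2 < ?w ^ ?N" using iff by simp
  have "Suc ?N \<notin> ?S" unfolding N_omega_def using Max_ge[OF fin] not_less_eq_eq by blast
  then show "?w ^ Suc ?N \<le> \<epsilon>\<^sup>2" using iff[of "Suc ?N"] by (simp only: mem_Collect_eq not_less)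
qed

theorem theorem1:
  fixes \<gamma> \<epsilon> :: real
    and H :: "nat \<Rightarrow> ((nat \<Rightarrow> real) \<Rightarrow> real) set"
    and ip :: "nat \<Rightarrow> ((nat \<Rightarrow> real) \<Rightarrow> real) \<Rightarrow> ((nat \<Rightarrow> real) \<Rightarrow> real) \<Rightarrow> real"
  assumes "0 < \<gamma>"
    and "\<And>d. 1 \<le> d \<Longrightarrow> rkhs (Rd d) (H d) (ip d) (gauss_kernel \<gamma> d)"
    and "0 < \<epsilon>" and "\<epsilon> < 1"
  shows "(\<lambda>d. real (info_complexity (H d) (ip d) d \<epsilon>)
              - real d ^ N_omega \<gamma> \<epsilon> / fact (N_omega \<gamma> \<epsilon>))
         \<in> O(\<lambda>d. real d powi (int (N_omega \<gamma> \<epsilon>) - 1))"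
proof -
  obtain a where a: "0 < a" "\<gamma>\<^sup>2 = a + a\<^sup>2" and w: "omega \<gamma> = a / (1 + a)"
    using omega_parametrization[OF assms(1)] .
  let ?N = "N_omega \<gamma> \<epsilon>"
  have "0 < omega \<gamma>" "omega \<gamma> < 1" using a w by simp_all
  note bounds = N_omega_bounds[OF this assms(3,4)]
  have eq: "real (info_complexity (H d) (ip d) d \<epsilon>) - real d ^ ?N / fact ?N
      = (1 / fact ?N) * (pochhammer (real d + 1) ?N - real d ^ ?N)" if "1 \<le> d" for d
  proof -
    interpret rkhs "Rd d" "H d" "ip d" "gauss_kernel \<gamma> d" using assms(2) that .
    interpret gaussian_rkhs \<gamma> d "H d" "ip d" a by standard (use a in auto)
    have "info_complexity (H d) (ip d) d \<epsilon> = (?N + d) choose ?N"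
      using bounds unfolding w by (intro info_complexity_eq assms(3))
    then show ?thesis by (simp add: binomial_eq_pochhammer diff_divide_distrib)
  qed
  have "(\<lambda>d. (1 / fact ?N) * (pochhammer (real d + 1) ?N - real d ^ ?N))
      \<in> O(\<lambda>d. real d powi (int ?N - 1))"
    using pochhammer_minus_power_bigo by simp
  also have "?this \<longleftrightarrow> ?thesis"
    using eq by (intro landau_o.big.in_cong eventually_mono[OF eventually_ge_at_top[of 1]]) simp
  finally show ?thesis .
qed

end
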